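(* Consider the 4-cell uplink network described in the context, with block fading and network coherence bound $\tau_{\max}\ge 3$. Its (sum) DoF equals $8/3$, both with no CSIT and with perfect global CSIT, and both with and without the spatially i.i.d. fading assumption.
   Context: There are eight single-antenna transmitters (users) $a_1,a_2,b_1,b_2,c_1,c_2,d_1,d_2$ and four single-antenna receivers (base stations) $A,B,C,D$. User $x_i$ has one independent message $W_{x_i}$ desired by base station $X$ (e.g. $W_{a_1},W_{a_2}$ are desired by $A$). Connectivity: $A$ hears exactly $a_1,a_2,b_1,c_2$; $B$ hears exactly $a_1,b_1,b_2,d_2$; $C$ hears exactly $a_2,c_2,c_1,d_1$; $D$ hears exactly $c_1,d_1,b_2,d_2$. At channel use $n$, receiver $r$ observes $Y_r(n)=\sum_t c_{rt}H_{rt}(n)X_t(n)+Z_r(n)$ with $c_{rt}\in\{0,1\}$ this connectivity, i.i.d. zero-mean unit-variance circularly symmetric complex Gaussian noise, and $E|X_t|^2\le P$. Channel coefficient magnitudes lie in a fixed interval bounded away from $0$ and $\infty$; channels are independent across links. Block fading: all channels constant within blocks of a common length $\tau$, i.i.d. across blocks from a continuous distribution, with $\tau$ a fixed integer in $[1,\tau_{\max}]$ chosen by the designer and known to all. Spatially i.i.d. fading means channel processes are also identically distributed across links. Each receiver knows its channels from the transmitters it hears. No CSIT: transmitters know connectivity and statistics but not channel realizations. DoF = $\lim_{P\to\infty}$ of sum capacity over $\log P$. *)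

theory Defs
  imports "HOL-Probability.Probability"
begin

datatype tx = a1 | a2 | b1 | b2 | c1 | c2 | d1 | d2
datatype rx = RA | RB | RC | RD

fun dest :: "tx \<Rightarrow> rx" where
  "dest a1 = RA" | "dest a2 = RA" | "dest b1 = RB" | "dest b2 = RB"
| "dest c1 = RC" | "dest c2 = RC" | "dest d1 = RD" | "dest d2 = RD"

fun hears :: "rx \<Rightarrow> tx set" where
  "hears RA = {a1, a2, b1, c2}"
| "hears RB = {a1, b1, b2, d2}"
| "hears RC = {a2, c2, c1, d1}"
| "hears RD = {c1, d1, b2, d2}"

definition conn :: "rx \<Rightarrow> tx \<Rightarrow> bool" where
  "conn r t \<longleftrightarrow> t \<in> hears r"

datatype csit = NoCSIT | PerfectCSIT

text \<open>Circularly symmetric complex Gaussian, zero mean, unit variance: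
real and imaginary parts independent N(0,1/2).\<close>
definition cgauss :: "complex measure" where
  "cgauss = distr
     (density lborel (normal_density 0 (sqrt (1/2))) \<Otimes>\<^sub>M
      density lborel (normal_density 0 (sqrt (1/2))))
     borel (\<lambda>(x, y). Complex x y)"

text \<open>Probability spaces for a code of block length N with message set sizes M:
uniform independent messages, block fading coefficients (i.i.d. across blocks,
independent across links with per-link laws nu), i.i.d. noise.
A fading sample g maps block index b and link (r,t) to the coefficient.\<close>
definition msg_space :: "(tx \<Rightarrow> nat) \<Rightarrow> (tx \<Rightarrow> nat) measure" where
  "msg_space M = PiM UNIV (\<lambda>t. measure_pmf (pmf_of_set {..<M t}))"

definition fade_space ::
  "nat \<Rightarrow> (rx \<times> tx \<Rightarrow> complex measure) \<Rightarrow> (nat \<Rightarrow> rx \<times> tx \<Rightarrow> complex) measure" where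
  "fade_space N \<nu> = PiM {..<N} (\<lambda>b. PiM UNIV \<nu>)"

definition noise_space :: "nat \<Rightarrow> (nat \<times> rx \<Rightarrow> complex) measure" where
  "noise_space N = PiM ({..<N} \<times> UNIV) (\<lambda>_. cgauss)"

definition Omega ::
  "(tx \<Rightarrow> nat) \<Rightarrow> nat \<Rightarrow> (rx \<times> tx \<Rightarrow> complex measure)
   \<Rightarrow> ((tx \<Rightarrow> nat) \<times> (nat \<Rightarrow> rx \<times> tx \<Rightarrow> complex) \<times> (nat \<times> rx \<Rightarrow> complex)) measure" where
  "Omega M N \<nu> = msg_space M \<Otimes>\<^sub>M (fade_space N \<nu> \<Otimes>\<^sub>M noise_space N)"

definition chan :: "nat \<Rightarrow> (nat \<Rightarrow> rx \<times> tx \<Rightarrow> complex) \<Rightarrow> nat \<Rightarrow> rx \<Rightarrow> tx \<Rightarrow> complex" where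
  "chan \<tau> g n r t = g (n div \<tau>) (r, t)"

type_synonym encoder = "tx \<Rightarrow> nat \<Rightarrow> (nat \<Rightarrow> rx \<times> tx \<Rightarrow> complex) \<Rightarrow> nat \<Rightarrow> complex"
type_synonym decoder = "rx \<Rightarrow> (nat \<Rightarrow> complex) \<Rightarrow> (nat \<Rightarrow> tx \<Rightarrow> complex) \<Rightarrow> tx \<Rightarrow> nat"

definition tx_sig :: "csit \<Rightarrow> encoder \<Rightarrow> (tx \<Rightarrow> nat) \<Rightarrow> (nat \<Rightarrow> rx \<times> tx \<Rightarrow> complex)
   \<Rightarrow> tx \<Rightarrow> nat \<Rightarrow> complex" where
  "tx_sig s enc w g t n = enc t (w t) (if s = PerfectCSIT then g else (\<lambda>_ _. 0)) n"

definition rx_sig :: "csit \<Rightarrow> nat \<Rightarrow> encoder \<Rightarrow> (tx \<Rightarrow> nat) \<Rightarrow> (nat \<Rightarrow> rx \<times> tx \<Rightarrow> complex)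
   \<Rightarrow> (nat \<times> rx \<Rightarrow> complex) \<Rightarrow> rx \<Rightarrow> nat \<Rightarrow> complex" where
  "rx_sig s \<tau> enc w g z r n =
     (\<Sum>t\<in>UNIV. if conn r t then chan \<tau> g n r t * tx_sig s enc w g t n else 0) + z (n, r)"

definition estimate :: "csit \<Rightarrow> nat \<Rightarrow> nat \<Rightarrow> encoder \<Rightarrow> decoder \<Rightarrow> (tx \<Rightarrow> nat)
   \<Rightarrow> (nat \<Rightarrow> rx \<times> tx \<Rightarrow> complex) \<Rightarrow> (nat \<times> rx \<Rightarrow> complex) \<Rightarrow> tx \<Rightarrow> nat" where
  "estimate s \<tau> N enc dec w g z t =
     dec (dest t)
       (\<lambda>n. if n < N then rx_sig s \<tau> enc w g z (dest t) n else 0)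
       (\<lambda>n t'. if n < N \<and> conn (dest t) t' then chan \<tau> g n (dest t) t' else 0) t"

definition err_event :: "csit \<Rightarrow> nat \<Rightarrow> (rx \<times> tx \<Rightarrow> complex measure) \<Rightarrow> nat \<Rightarrow> (tx \<Rightarrow> nat)
   \<Rightarrow> encoder \<Rightarrow> decoder \<Rightarrow> ((tx \<Rightarrow> nat) \<times> (nat \<Rightarrow> rx \<times> tx \<Rightarrow> complex) \<times> (nat \<times> rx \<Rightarrow> complex)) set" where
  "err_event s \<tau> \<nu> N M enc dec =
     {\<omega> \<in> space (Omega M N \<nu>).
        case \<omega> of (w, g, z) \<Rightarrow> (\<exists>t. estimate s \<tau> N enc dec w g z t \<noteq> w t)}"

definition good_code :: "csit \<Rightarrow> nat \<Rightarrow> (rx \<times> tx \<Rightarrow> complex measure) \<Rightarrow> real \<Rightarrow> nat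
   \<Rightarrow> (tx \<Rightarrow> nat) \<Rightarrow> encoder \<Rightarrow> decoder \<Rightarrow> real \<Rightarrow> bool" where
  "good_code s \<tau> \<nu> P N M enc dec \<epsilon> \<longleftrightarrow>
     (\<forall>t. 1 \<le> M t) \<and>
     (\<forall>t n. n < N \<longrightarrow>
        (\<lambda>(w, g, z). tx_sig s enc w g t n) \<in> borel_measurable (Omega M N \<nu>) \<and>
        (\<integral>\<^sup>+ \<omega>. ennreal ((cmod (case \<omega> of (w, g, z) \<Rightarrow> tx_sig s enc w g t n))\<^sup>2)
            \<partial>(Omega M N \<nu>)) \<le> ennreal P) \<and>
     err_event s \<tau> \<nu> N M enc dec \<in> sets (Omega M N \<nu>) \<and>
     measure (Omega M N \<nu>) (err_event s \<tau> \<nu> N M enc dec) \<le> \<epsilon>"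

definition achievable :: "csit \<Rightarrow> nat \<Rightarrow> (rx \<times> tx \<Rightarrow> complex measure) \<Rightarrow> real
   \<Rightarrow> (tx \<Rightarrow> real) \<Rightarrow> bool" where
  "achievable s \<tau> \<nu> P R \<longleftrightarrow>
     (\<forall>t. 0 \<le> R t) \<and>
     (\<forall>\<epsilon>>0. \<forall>N0. \<exists>N\<ge>N0. 0 < N \<and> (\<exists>M enc dec.
        good_code s \<tau> \<nu> P N M enc dec \<epsilon> \<and>
        (\<forall>t. R t - \<epsilon> \<le> log 2 (real (M t)) / real N)))"

definition sum_capacity_tau :: "csit \<Rightarrow> nat \<Rightarrow> (rx \<times> tx \<Rightarrow> complex measure) \<Rightarrow> real \<Rightarrow> real" where
  "sum_capacity_tau s \<tau> \<nu> P = Sup {(\<Sum>t\<in>UNIV. R t) | R. achievable s \<tau> \<nu> P R}"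

text \<open>Sum capacity when the designer chooses the coherence block length
tau in [1, tau_max].\<close>
definition sum_capacity :: "csit \<Rightarrow> nat \<Rightarrow> (rx \<times> tx \<Rightarrow> complex measure) \<Rightarrow> real \<Rightarrow> real" where
  "sum_capacity s \<tau>max \<nu> P = Max ((\<lambda>\<tau>. sum_capacity_tau s \<tau> \<nu> P) ` {1..\<tau>max})"

text \<open>Admissible fading laws: one law per link (links independent by the
product construction), each a continuous (absolutely continuous w.r.t.
Lebesgue measure on C) probability distribution with magnitudes a.s. in
[hmin, hmax], 0 < hmin.\<close>
definition admissible_fading :: "(rx \<times> tx \<Rightarrow> complex measure) \<Rightarrow> real \<Rightarrow> real \<Rightarrow> bool" where
  "admissible_fading \<nu> hmin hmax \<longleftrightarrow>
     0 < hmin \<and> hmin \<le> hmax \<and>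
     (\<forall>l. prob_space (\<nu> l) \<and> sets (\<nu> l) = sets borel \<and>
          absolutely_continuous lborel (\<nu> l) \<and>
          (AE h in \<nu> l. hmin \<le> cmod h \<and> cmod h \<le> hmax))"

definition spatially_iid :: "(rx \<times> tx \<Rightarrow> complex measure) \<Rightarrow> bool" where
  "spatially_iid \<nu> \<longleftrightarrow> (\<forall>l l'. \<nu> l = \<nu> l')"

end

theory Submission
  imports Defs "HOL-Real_Asymp.Real_Asymp"
begin

text \<open>Converse: fix a receiver \<open>r\<close> and an interferer \<open>t\<close> heard by it. Replacing the noise at \<open>r\<close> and at
  \<open>dest t\<close> by suitable correlated Gaussians of variance about \<open>P\<close> and \<open>O(1)\<close> costs a density factor
  \<open>(c P)^N\<close>, and makes the observation at \<open>r\<close> independent of all messages, while that at \<open>dest t\<close>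
  depends on the messages of \<open>r\<close> but not on that of \<open>t\<close>. Hence at most one choice of the three messages
  is decoded correctly, so these three rates sum to at most \<open>log P + O(1)\<close>. Eight such triples cover
  each user three times.

  Achievability: with coherence time 3, sending each symbol along a fixed direction in three uses
  lets every receiver align its two interferers and zero-force. Each user then has an
  interference-free channel of bounded gain with 1/3 of the uses; a QAM constellation of size
  \<open>P^(1 - o(1))\<close> combined with a Gilbert-Varshamov code correcting a vanishing fraction of
  symbols attains \<open>(1/3 - o(1)) log P\<close>.\<close>

text \<open>The model speaks of error probabilities only, so the converse avoids entropies: for a
  fixed fading realization it counts the message tuples that a single noise sample can leave
  correctly decoded. Fixing the realization allows the encoders to depend on it, whereas the coding
  scheme ignores it; hence both CSIT cases meet at the same value. The new noise may cost only one
  power of \<open>P\<close> per channel use. At \<open>r\<close> the standard deviation becomes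
  \<open>sqrt P\<close>, and shifting such noise by a signal of energy about \<open>N * P\<close>
  costs a factor that is merely exponential in \<open>N\<close>. At \<open>dest t\<close> bounded
  variance is enough: under the original law the noise at \<open>r\<close> is of order one, and the
  shift at \<open>dest t\<close> is a bounded multiple of it. In the achievability part
  \<open>P\<close> is fixed while the block length grows, so uncoded symbols would almost surely
  contain an error. This forces an outer code; the fraction of symbols that it corrects stays
  positive for each \<open>P\<close> and only tends to 0 as \<open>P\<close> grows. Crude counting
  bounds such as \<open>2 ^ n\<close> are affordable throughout, since they cost a bounded number of
  bits per use and vanish against \<open>log 2 P\<close>.\<close>

lemma UNIV_tx: "(UNIV :: tx set) = {a1, a2, b1, b2, c1, c2, d1, d2}"
  using tx.exhaust by auto

lemma UNIV_rx: "(UNIV :: rx set) = {RA, RB, RC, RD}"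
  using rx.exhaust by auto

lemma finite_tx [simp]: "finite (A :: tx set)"
  by (rule finite_subset[OF subset_UNIV]) (simp add: UNIV_tx)

lemma finite_rx [simp]: "finite (A :: rx set)"
  by (rule finite_subset[OF subset_UNIV]) (simp add: UNIV_rx)

subsection \<open>Change of measure for Gaussian noise\<close>

abbreviation gauss_half :: "real measure" where
  "gauss_half \<equiv> density lborel (normal_density 0 (sqrt (1/2)))"

lemma prob_space_gauss_half: "prob_space gauss_half"
  by (rule prob_space_normal_density) simp

lemma measurable_Complex [measurable]: "(\<lambda>(x, y). Complex x y) \<in> borel_measurable (borel \<Otimes>\<^sub>M borel)"
  by (simp add: Complex_eq case_prod_beta')

lemma measurable_Complex_gauss:
  "(\<lambda>(x, y). Complex x y) \<in> borel_measurable (gauss_half \<Otimes>\<^sub>M gauss_half)"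
  by (subst measurable_cong_sets[OF sets_pair_measure_cong refl]) (auto intro: measurable_Complex)

lemma sets_cgauss [simp, measurable_cong]: "sets cgauss = sets borel"
  by (simp add: cgauss_def)

lemma space_cgauss [simp]: "space cgauss = UNIV"
  by (simp add: cgauss_def)

lemma prob_space_cgauss: "prob_space cgauss"
proof -
  interpret G: prob_space gauss_half by (rule prob_space_gauss_half)
  interpret P: pair_prob_space gauss_half gauss_half ..
  show ?thesis unfolding cgauss_def
    by (rule P.prob_space_distr[OF measurable_Complex_gauss])
qed

lemma nn_integral_cgauss:
  assumes [measurable]: "F \<in> borel_measurable borel"
  shows "(\<integral>\<^sup>+ z. F z \<partial>cgauss) = (\<integral>\<^sup>+ x. \<integral>\<^sup>+ y. F (Complex x y) \<partial>gauss_half \<partial>gauss_half)"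
proof -
  interpret G: prob_space gauss_half by (rule prob_space_gauss_half)
  have "(\<integral>\<^sup>+ z. F z \<partial>cgauss) =
      (\<integral>\<^sup>+ p. F (case p of (x, y) \<Rightarrow> Complex x y) \<partial>(gauss_half \<Otimes>\<^sub>M gauss_half))"
    unfolding cgauss_def by (rule nn_integral_distr[OF measurable_Complex_gauss]) simp
  also have "\<dots> = (\<integral>\<^sup>+ x. \<integral>\<^sup>+ y. F (Complex x y) \<partial>gauss_half \<partial>gauss_half)"
    by (subst G.nn_integral_fst[symmetric])
      (auto intro!: measurable_compose[OF measurable_Complex_gauss])
  finally show ?thesis .
qed

text \<open>The densities compare pointwise: \<open>((x - b) / a)\<^sup>2\<close> is at most
  \<open>x\<^sup>2 / 2 + 2 * b\<^sup>2 / a\<^sup>2\<close> when \<open>a\<close> is at least 2, so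
  the widened and shifted Gaussian dominates up to a constant even after a factor
  \<open>exp (x\<^sup>2 / 4)\<close> is inserted. That factor is a reserve, spent later on a shift
  of another noise sample that depends on \<open>x\<close>. The factor \<open>a\<close> is the
  Jacobian of the substitution.\<close>

lemma gauss_half_affine_bound:
  fixes F :: "real \<Rightarrow> ennreal" and a b :: real
  assumes [measurable]: "F \<in> borel_measurable borel" and a: "2 \<le> a"
  shows "(\<integral>\<^sup>+ x. F x * ennreal (exp (x\<^sup>2 / 4)) \<partial>gauss_half)
    \<le> ennreal (a * exp (2 * b\<^sup>2 / a\<^sup>2)) * (\<integral>\<^sup>+ x. F (a * x + b) \<partial>gauss_half)"
proof -
  let ?\<phi> = "normal_density 0 (sqrt (1/2))"
  have pt: "exp (x\<^sup>2 / 4) * ?\<phi> x \<le> exp (2 * b\<^sup>2 / a\<^sup>2) * ?\<phi> ((x - b) / a)" for x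
  proof -
    have "(x - b)\<^sup>2 \<le> 2 * x\<^sup>2 + 2 * b\<^sup>2"
      using sum_squares_bound[of x "-b"] by (simp add: power2_eq_square algebra_simps)
    then have "((x - b) / a)\<^sup>2 \<le> 2 * x\<^sup>2 / a\<^sup>2 + 2 * b\<^sup>2 / a\<^sup>2"
      by (simp add: power_divide add_divide_distrib[symmetric] divide_right_mono)
    moreover have "2 * x\<^sup>2 / a\<^sup>2 \<le> x\<^sup>2 / 2"
      using divide_left_mono[OF power_mono[OF a, of 2], of "2 * x\<^sup>2"] a by simp
    ultimately have "x\<^sup>2 / 4 - x\<^sup>2 \<le> 2 * b\<^sup>2 / a\<^sup>2 - ((x - b) / a)\<^sup>2"
      using zero_le_power2[of x] by linarith
    then have "exp (x\<^sup>2 / 4 - x\<^sup>2) \<le> exp (2 * b\<^sup>2 / a\<^sup>2 - ((x - b) / a)\<^sup>2)" by simp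
    moreover have "?\<phi> u = 1 / sqrt pi * exp (- u\<^sup>2)" for u
      by (simp add: normal_density_def)
    moreover have "exp (x\<^sup>2 / 4 - x\<^sup>2) = exp (x\<^sup>2 / 4) * exp (- x\<^sup>2)"
      "exp (2 * b\<^sup>2 / a\<^sup>2 - ((x - b) / a)\<^sup>2) = exp (2 * b\<^sup>2 / a\<^sup>2) * exp (- ((x - b) / a)\<^sup>2)"
      by (simp_all flip: exp_add)
    ultimately show ?thesis
      by (simp add: divide_right_mono)
  qed
  have "(\<integral>\<^sup>+ x. F x * ennreal (exp (x\<^sup>2 / 4)) \<partial>gauss_half)
      = (\<integral>\<^sup>+ x. F x * ennreal (exp (x\<^sup>2 / 4) * ?\<phi> x) \<partial>lborel)"
    by (subst nn_integral_density) (auto simp: ennreal_mult ac_simps)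
  also have "\<dots> \<le> (\<integral>\<^sup>+ x. F x * ennreal (exp (2 * b\<^sup>2 / a\<^sup>2) * ?\<phi> ((x - b) / a)) \<partial>lborel)"
    by (intro nn_integral_mono mult_left_mono ennreal_leI pt) auto
  also have "\<dots> = ennreal a * (\<integral>\<^sup>+ x. F (b + a * x) * ennreal (exp (2 * b\<^sup>2 / a\<^sup>2) * ?\<phi> x) \<partial>lborel)"
    using a by (subst nn_integral_real_affine[where c = a and t = b]) auto
  also have "(\<integral>\<^sup>+ x. F (b + a * x) * ennreal (exp (2 * b\<^sup>2 / a\<^sup>2) * ?\<phi> x) \<partial>lborel)
      = ennreal (exp (2 * b\<^sup>2 / a\<^sup>2)) * (\<integral>\<^sup>+ x. F (a * x + b) \<partial>gauss_half)"
    by (subst nn_integral_density)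
      (auto simp: ennreal_mult ac_simps nn_integral_cmult[symmetric])
  finally show ?thesis
    using a by (simp add: ennreal_mult mult.assoc)
qed

text \<open>The real bound is applied to the imaginary and then to the real part. Two Jacobians give
  \<open>a\<^sup>2\<close>, which is the single power of \<open>P\<close> per channel use once
  \<open>a = sqrt P\<close>.\<close>

lemma cgauss_affine_bound:
  fixes F :: "complex \<Rightarrow> ennreal" and a :: real and b :: complex
  assumes [measurable]: "F \<in> borel_measurable borel" and a: "2 \<le> a"
  shows "(\<integral>\<^sup>+ z. F z * ennreal (exp ((cmod z)\<^sup>2 / 4)) \<partial>cgauss)
    \<le> ennreal (a\<^sup>2 * exp (2 * (cmod b)\<^sup>2 / a\<^sup>2)) * (\<integral>\<^sup>+ z. F (of_real a * z + b) \<partial>cgauss)"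
proof -
  interpret G: prob_space gauss_half by (rule prob_space_gauss_half)
  let ?k = "\<lambda>u. ennreal (a * exp (2 * u\<^sup>2 / a\<^sup>2))"
  have [measurable]: "(\<lambda>y. F (Complex (f y) (g y))) \<in> borel_measurable N"
    if "f \<in> borel_measurable N" "g \<in> borel_measurable N" for f g and N :: "'z measure"
    using that by (simp add: Complex_eq)
  have "(\<integral>\<^sup>+ z. F z * ennreal (exp ((cmod z)\<^sup>2 / 4)) \<partial>cgauss)
      = (\<integral>\<^sup>+ x. \<integral>\<^sup>+ y. F (Complex x y) * ennreal (exp (x\<^sup>2/4)) * ennreal (exp (y\<^sup>2/4)) \<partial>gauss_half \<partial>gauss_half)"
    by (subst nn_integral_cgauss)
      (auto intro!: nn_integral_cong simp: cmod_power2 add_divide_distrib exp_add ennreal_mult ac_simps)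
  also have "\<dots> \<le> (\<integral>\<^sup>+ x. ?k (Im b) * (\<integral>\<^sup>+ y. F (Complex x (a * y + Im b)) * ennreal (exp (x\<^sup>2/4)) \<partial>gauss_half) \<partial>gauss_half)"
    by (intro nn_integral_mono
        gauss_half_affine_bound[where F = "\<lambda>y. F (Complex x y) * ennreal (exp (x\<^sup>2/4))" for x] a) auto
  also have "\<dots> = ?k (Im b) * (\<integral>\<^sup>+ x. (\<integral>\<^sup>+ y. F (Complex x (a * y + Im b)) \<partial>gauss_half) * ennreal (exp (x\<^sup>2/4)) \<partial>gauss_half)"
    by (subst nn_integral_cmult[symmetric]) (auto intro!: nn_integral_cong simp: nn_integral_multc)
  also have "\<dots> \<le> ?k (Im b) * (?k (Re b) * (\<integral>\<^sup>+ x. \<integral>\<^sup>+ y. F (Complex (a * x + Re b) (a * y + Im b)) \<partial>gauss_half \<partial>gauss_half))"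
    by (intro mult_left_mono
        gauss_half_affine_bound[where F = "\<lambda>x. \<integral>\<^sup>+ y. F (Complex x (a * y + Im b)) \<partial>gauss_half"] a) auto
  also have "(\<integral>\<^sup>+ x. \<integral>\<^sup>+ y. F (Complex (a * x + Re b) (a * y + Im b)) \<partial>gauss_half \<partial>gauss_half)
      = (\<integral>\<^sup>+ z. F (of_real a * z + b) \<partial>cgauss)"
    by (subst nn_integral_cgauss) (auto intro!: nn_integral_cong arg_cong[where f = F] simp: complex_eq_iff)
  also have "?k (Im b) * (?k (Re b) * I) = ennreal (a\<^sup>2 * exp (2 * (cmod b)\<^sup>2 / a\<^sup>2)) * I" for I
  proof -
    have "a * exp (2 * (Im b)\<^sup>2 / a\<^sup>2) * (a * exp (2 * (Re b)\<^sup>2 / a\<^sup>2)) = a\<^sup>2 * exp (2 * (cmod b)\<^sup>2 / a\<^sup>2)"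
      by (simp add: cmod_power2 distrib_left add_divide_distrib exp_add power2_eq_square[of a])
    then show ?thesis using a by (simp add: mult.assoc[symmetric] ennreal_mult[symmetric])
  qed
  finally show ?thesis .
qed

text \<open>Tensorization: the coordinate inequality holds for every test function, so it applies to
  the slice of \<open>F\<close> with all other coordinates frozen, and induction replaces one
  coordinate at a time.\<close>

lemma (in product_sigma_finite) nn_integral_PiM_bound:
  fixes w :: "'i \<Rightarrow> 'a \<Rightarrow> ennreal" and T :: "'i \<Rightarrow> 'a \<Rightarrow> 'a" and k :: "'i \<Rightarrow> ennreal"
  assumes "finite I"
    and "\<And>i. i \<in> I \<Longrightarrow> w i \<in> borel_measurable (M i)"
    and "\<And>i. i \<in> I \<Longrightarrow> T i \<in> measurable (M i) (M i)"
    and "\<And>i f. i \<in> I \<Longrightarrow> f \<in> borel_measurable (M i) \<Longrightarrow>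
      (\<integral>\<^sup>+ x. f x * w i x \<partial>M i) \<le> k i * (\<integral>\<^sup>+ x. f (T i x) \<partial>M i)"
    and "F \<in> borel_measurable (PiM I M)"
  shows "(\<integral>\<^sup>+ x. F x * (\<Prod>i\<in>I. w i (x i)) \<partial>PiM I M)
    \<le> (\<Prod>i\<in>I. k i) * (\<integral>\<^sup>+ x. F (\<lambda>i\<in>I. T i (x i)) \<partial>PiM I M)"
  using assms
proof (induction I arbitrary: F rule: finite_induct)
  case empty
  show ?case by (simp add: PiM_empty nn_integral_count_space_finite restrict_def)
next
  case (insert i I)
  note insert.prems(1,2,4)[measurable]
  have [measurable]: "\<And>j. j \<in> I \<Longrightarrow> w j \<in> borel_measurable (M j)"
    "\<And>j. j \<in> I \<Longrightarrow> T j \<in> measurable (M j) (M j)"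
    "w i \<in> borel_measurable (M i)" "T i \<in> measurable (M i) (M i)"
    using insert.prems by auto

  let ?G = "\<lambda>x. \<integral>\<^sup>+ y. F (x(i := T i y)) \<partial>M i"
  have upd: "(\<lambda>(x, y). x(i := T i y)) \<in> measurable (PiM I M \<Otimes>\<^sub>M M i) (PiM (insert i I) M)"
    by measurable
  have FG: "(\<lambda>(x, y). F (x(i := T i y))) \<in> borel_measurable (PiM I M \<Otimes>\<^sub>M M i)"
    using measurable_compose[OF upd insert.prems(4)] by (simp add: case_prod_beta')
  have G [measurable]: "?G \<in> borel_measurable (PiM I M)"
    using sigma_finite_measure.borel_measurable_nn_integral_fst[OF sigma_finite_measures FG] by simp
  have "(\<integral>\<^sup>+ x. F x * (\<Prod>j\<in>insert i I. w j (x j)) \<partial>PiM (insert i I) M)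
      = (\<integral>\<^sup>+ x. \<integral>\<^sup>+ y. F (x(i := y)) * (\<Prod>j\<in>insert i I. w j ((x(i := y)) j)) \<partial>M i \<partial>PiM I M)"
    by (rule product_nn_integral_insert[OF insert.hyps]) measurable
  also have "\<dots> = (\<integral>\<^sup>+ x. \<integral>\<^sup>+ y. (F (x(i := y)) * (\<Prod>j\<in>I. w j (x j))) * w i y \<partial>M i \<partial>PiM I M)"
  proof (intro nn_integral_cong)
    fix x y
    have "(\<Prod>j\<in>I. w j ((x(i := y)) j)) = (\<Prod>j\<in>I. w j (x j))"
      using insert.hyps by (intro prod.cong) auto
    then show "F (x(i := y)) * (\<Prod>j\<in>insert i I. w j ((x(i := y)) j)) = (F (x(i := y)) * (\<Prod>j\<in>I. w j (x j))) * w i y"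
      using insert.hyps by (simp add: ac_simps)
  qed
  also have "\<dots> \<le> (\<integral>\<^sup>+ x. k i * (\<integral>\<^sup>+ y. F (x(i := T i y)) * (\<Prod>j\<in>I. w j (x j)) \<partial>M i) \<partial>PiM I M)"
  proof (rule nn_integral_mono)
    fix x assume x: "x \<in> space (PiM I M)"
    have "(\<lambda>y. x(i := y)) \<in> measurable (M i) (PiM (insert i I) M)"
      using x by measurable
    then have "(\<lambda>y. F (x(i := y))) \<in> borel_measurable (M i)"
      using insert.prems(4) by (rule measurable_compose)
    then show "(\<integral>\<^sup>+ y. (F (x(i := y)) * (\<Prod>j\<in>I. w j (x j))) * w i y \<partial>M i)
        \<le> k i * (\<integral>\<^sup>+ y. F (x(i := T i y)) * (\<Prod>j\<in>I. w j (x j)) \<partial>M i)"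
      by (intro insert.prems(3)) auto
  qed
  also have "\<dots> = k i * (\<integral>\<^sup>+ x. ?G x * (\<Prod>j\<in>I. w j (x j)) \<partial>PiM I M)"
  proof -
    have "(\<integral>\<^sup>+ y. F (x(i := T i y)) * (\<Prod>j\<in>I. w j (x j)) \<partial>M i) = ?G x * (\<Prod>j\<in>I. w j (x j))"
      if x: "x \<in> space (PiM I M)" for x
    proof (rule nn_integral_multc)
      have "(\<lambda>y. x(i := T i y)) \<in> measurable (M i) (PiM (insert i I) M)"
        using x by measurable
      then show "(\<lambda>y. F (x(i := T i y))) \<in> borel_measurable (M i)"
        using insert.prems(4) by (rule measurable_compose)
    qed
    then have "(\<integral>\<^sup>+ x. k i * (\<integral>\<^sup>+ y. F (x(i := T i y)) * (\<Prod>j\<in>I. w j (x j)) \<partial>M i) \<partial>PiM I M)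
        = (\<integral>\<^sup>+ x. k i * (?G x * (\<Prod>j\<in>I. w j (x j))) \<partial>PiM I M)"
      by (intro nn_integral_cong) simp
    also have "\<dots> = k i * (\<integral>\<^sup>+ x. ?G x * (\<Prod>j\<in>I. w j (x j)) \<partial>PiM I M)"
      by (rule nn_integral_cmult) measurable
    finally show ?thesis .
  qed
  also have "\<dots> \<le> k i * ((\<Prod>j\<in>I. k j) * (\<integral>\<^sup>+ x. ?G (\<lambda>j\<in>I. T j (x j)) \<partial>PiM I M))"
    using insert.prems by (intro mult_left_mono insert.IH G) auto
  also have "(\<integral>\<^sup>+ x. ?G (\<lambda>j\<in>I. T j (x j)) \<partial>PiM I M)
      = (\<integral>\<^sup>+ x. \<integral>\<^sup>+ y. F (\<lambda>j\<in>insert i I. T j ((x(i := y)) j)) \<partial>M i \<partial>PiM I M)"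
    using insert.hyps by (intro nn_integral_cong arg_cong[where f = F]) (auto simp: fun_eq_iff)
  also have "\<dots> = (\<integral>\<^sup>+ x. F (\<lambda>j\<in>insert i I. T j (x j)) \<partial>PiM (insert i I) M)"
    by (rule product_nn_integral_insert[symmetric, OF insert.hyps])
      (rule measurable_compose[OF _ insert.prems(4)], measurable)
  finally show ?case
    using insert.hyps by (simp add: mult.assoc del: restrict_apply)
qed


text \<open>For noise that is the image of \<open>\<zeta>\<close> under this map, receiver \<open>r\<close> (with noiseless signal \<open>f\<close>)
  sees \<open>a * \<zeta>\<close>, which does not depend on the messages, and \<open>r'\<close> sees a noisy version of
  \<open>\<rho>\<close> times that, shifted.\<close>
definition retarget :: "nat \<Rightarrow> rx \<Rightarrow> rx \<Rightarrow> (nat \<Rightarrow> complex) \<Rightarrow> real \<Rightarrow> (nat \<Rightarrow> complex) \<Rightarrow> real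
    \<Rightarrow> (nat \<times> rx \<Rightarrow> complex) \<Rightarrow> nat \<times> rx \<Rightarrow> complex" where
  "retarget N r r' f a \<rho> s \<zeta> = (\<lambda>i\<in>{..<N} \<times> UNIV.
     if snd i = r then of_real a * \<zeta> i - f (fst i)
     else if snd i = r' then of_real s * \<zeta> i + \<rho> (fst i) * (of_real a * \<zeta> (fst i, r) - f (fst i))
     else \<zeta> i)"

lemma product_sigma_finite_cgauss: "product_sigma_finite (\<lambda>_. cgauss)"
  by (simp add: product_sigma_finite_def prob_space_imp_sigma_finite prob_space_cgauss)

lemma measurable_retarget [measurable]:
  "retarget N r r' f a \<rho> s \<in> measurable (noise_space N) (noise_space N)"
  unfolding noise_space_def retarget_def
proof (rule measurable_restrict)
  fix i :: "nat \<times> rx" assume i: "i \<in> {..<N} \<times> UNIV"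
  then have [measurable]: "(\<lambda>\<zeta>. \<zeta> i) \<in> borel_measurable (Pi\<^sub>M ({..<N} \<times> UNIV) (\<lambda>_. cgauss))"
    "(\<lambda>\<zeta>. \<zeta> (fst i, r)) \<in> borel_measurable (Pi\<^sub>M ({..<N} \<times> UNIV) (\<lambda>_. cgauss))"
    using measurable_component_singleton[of i "{..<N} \<times> UNIV" "\<lambda>_. cgauss"]
      measurable_component_singleton[of "(fst i, r)" "{..<N} \<times> UNIV" "\<lambda>_. cgauss"]
    by (auto simp: measurable_cong_sets[OF refl sets_cgauss])
  show "(\<lambda>\<zeta>. if snd i = r then of_real a * \<zeta> i - f (fst i)
     else if snd i = r' then of_real s * \<zeta> i + \<rho> (fst i) * (of_real a * \<zeta> (fst i, r) - f (fst i))
     else \<zeta> i) \<in> measurable (Pi\<^sub>M ({..<N} \<times> UNIV) (\<lambda>_. cgauss)) cgauss"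
    unfolding measurable_cong_sets[OF refl sets_cgauss] by measurable
qed

lemma prod_rx_if:
  fixes g :: "nat \<Rightarrow> 'c :: comm_monoid_mult"
  assumes "r \<in> Q"
  shows "(\<Prod>i\<in>{..<N::nat} \<times> Q. if snd i = (r :: rx) then g (fst i) else 1) = (\<Prod>n<N. g n)"
proof -
  have "(\<Prod>i\<in>{..<N::nat} \<times> Q. if snd i = r then g (fst i) else 1) = (\<Prod>n<N. \<Prod>q\<in>Q. if q = r then g n else 1)"
    unfolding prod.cartesian_product by (simp add: case_prod_beta')
  also have "\<dots> = (\<Prod>n<N. g n)" using assms by simp
  finally show ?thesis .
qed

text \<open>The samples at \<open>r'\<close> are integrated with those at \<open>r\<close> frozen.
  Shifting the former by \<open>\<rho> * x\<close> costs
  \<open>exp (2 * |\<rho> * x|^2 / s^2)\<close>, which by the bound on \<open>\<rho>\<close> is at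
  most \<open>exp (|x|^2 / 4)\<close>. This is exactly the weight that the affine bound can carry
  when the samples at \<open>r\<close> are widened by \<open>a\<close> and shifted by
  \<open>- f\<close> afterwards. The order matters: the shift at \<open>r'\<close> uses the original
  sample \<open>x\<close> in the cost, and its retargeted value in the resulting map.\<close>

lemma nn_integral_noise_retarget:
  assumes rr: "r \<noteq> r'" and a: "2 \<le> a" and s: "2 \<le> s"
    and \<rho>: "\<And>n. n < N \<Longrightarrow> 8 * (cmod (\<rho> n))\<^sup>2 \<le> s\<^sup>2"
    and F: "F \<in> borel_measurable (noise_space N)"
  shows "(\<integral>\<^sup>+ z. F z \<partial>noise_space N)
    \<le> ennreal ((s\<^sup>2 * a\<^sup>2) ^ N * exp (2 * (\<Sum>n<N. (cmod (f n))\<^sup>2) / a\<^sup>2))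
      * (\<integral>\<^sup>+ \<zeta>. F (retarget N r r' f a \<rho> s \<zeta>) \<partial>noise_space N)"
proof -
  interpret product_sigma_finite "\<lambda>_ :: nat \<times> rx. cgauss" by (rule product_sigma_finite_cgauss)
  define I1 I2 where "I1 = {..<N} \<times> (UNIV - {r'})" and "I2 = {..<N} \<times> {r'}"
  have fin [simp]: "finite I1" "finite I2" and disj: "I1 \<inter> I2 = {}"
    and un: "{..<N} \<times> UNIV = I1 \<union> I2"
    unfolding I1_def I2_def by auto
  have noise: "noise_space N = PiM (I1 \<union> I2) (\<lambda>_. cgauss)"
    by (simp add: noise_space_def un)
  note F' = F[unfolded noise]
  interpret P2: sigma_finite_measure "PiM I2 (\<lambda>_. cgauss)" by (rule sigma_finite) simp
  define T2 where "T2 = (\<lambda>(x :: nat \<times> rx \<Rightarrow> complex) (i :: nat \<times> rx) y. of_real s * y + \<rho> (fst i) * x (fst i, r))"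
  define T1 where "T1 = (\<lambda>i :: nat \<times> rx. \<lambda>z. if snd i = r then of_real a * z - f (fst i) else z)"
  define w1 where "w1 = (\<lambda>i :: nat \<times> rx. \<lambda>z. if snd i = r then ennreal (exp ((cmod z)\<^sup>2 / 4)) else 1)"
  define k1 where "k1 = (\<lambda>i :: nat \<times> rx. if snd i = r then ennreal (a\<^sup>2 * exp (2 * (cmod (f (fst i)))\<^sup>2 / a\<^sup>2)) else 1)"
  define H where "H = (\<lambda>x. \<integral>\<^sup>+ y. F (merge I1 I2 (x, \<lambda>i\<in>I2. T2 x i (y i))) \<partial>PiM I2 (\<lambda>_. cgauss))"
  have comp1: "(\<lambda>x. x i) \<in> borel_measurable (PiM I1 (\<lambda>_. cgauss))" if "i \<in> I1" for i
    using measurable_component_singleton[OF that, of "\<lambda>_. cgauss"]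
    by (simp add: measurable_cong_sets[OF refl sets_cgauss])
  have comp2: "(\<lambda>x. x i) \<in> borel_measurable (PiM I2 (\<lambda>_. cgauss))" if "i \<in> I2" for i
    using measurable_component_singleton[OF that, of "\<lambda>_. cgauss"]
    by (simp add: measurable_cong_sets[OF refl sets_cgauss])
  have r1: "(fst i, r) \<in> I1" if "i \<in> I2" for i
    using that rr by (auto simp: I1_def I2_def)
  have mH0: "(\<lambda>(x, y). F (merge I1 I2 (x, \<lambda>i\<in>I2. T2 x i (y i))))
      \<in> borel_measurable (PiM I1 (\<lambda>_. cgauss) \<Otimes>\<^sub>M PiM I2 (\<lambda>_. cgauss))"
  proof -
    have "(\<lambda>p. \<lambda>i\<in>I2. T2 (fst p) i (snd p i)) \<in> measurable (PiM I1 (\<lambda>_. cgauss) \<Otimes>\<^sub>M PiM I2 (\<lambda>_. cgauss)) (PiM I2 (\<lambda>_. cgauss))"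
    proof (rule measurable_restrict)
      fix i assume i: "i \<in> I2"
      note [measurable] = comp1[OF r1[OF i]] comp2[OF i]
      show "(\<lambda>p. T2 (fst p) i (snd p i)) \<in> measurable (PiM I1 (\<lambda>_. cgauss) \<Otimes>\<^sub>M PiM I2 (\<lambda>_. cgauss)) cgauss"
        unfolding measurable_cong_sets[OF refl sets_cgauss] T2_def by measurable
    qed
    then have "(\<lambda>p. merge I1 I2 (fst p, \<lambda>i\<in>I2. T2 (fst p) i (snd p i)))
        \<in> measurable (PiM I1 (\<lambda>_. cgauss) \<Otimes>\<^sub>M PiM I2 (\<lambda>_. cgauss)) (PiM (I1 \<union> I2) (\<lambda>_. cgauss))"
      by (intro measurable_compose[OF _ measurable_merge] measurable_Pair) auto
    from measurable_compose[OF this F'] show ?thesis by (simp add: case_prod_beta')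
  qed
  have mH: "H \<in> borel_measurable (PiM I1 (\<lambda>_. cgauss))"
    unfolding H_def using P2.borel_measurable_nn_integral_fst[OF mH0] by simp
  have inner: "(\<integral>\<^sup>+ y. F (merge I1 I2 (x, y)) \<partial>PiM I2 (\<lambda>_. cgauss))
      \<le> ennreal ((s\<^sup>2) ^ N) * (H x * (\<Prod>i\<in>I1. w1 i (x i)))"
    if x: "x \<in> space (PiM I1 (\<lambda>_. cgauss))" for x
  proof -
    have Fm: "(\<lambda>y. F (merge I1 I2 (x, y))) \<in> borel_measurable (PiM I2 (\<lambda>_. cgauss))"
      by (rule measurable_compose[OF _ F'], rule measurable_compose[OF _ measurable_merge])
        (use x in measurable)
    have "(\<integral>\<^sup>+ y. F (merge I1 I2 (x, y)) * (\<Prod>i\<in>I2. 1) \<partial>PiM I2 (\<lambda>_. cgauss))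
      \<le> (\<Prod>i\<in>I2. ennreal (s\<^sup>2 * exp ((cmod (x (fst i, r)))\<^sup>2 / 4))) *
        H x"
      unfolding H_def
    proof (rule nn_integral_PiM_bound)
      fix i and g :: "complex \<Rightarrow> ennreal" assume i: "i \<in> I2" and "g \<in> borel_measurable cgauss"
      then have g [measurable]: "g \<in> borel_measurable borel" by simp
      let ?b = "\<rho> (fst i) * x (fst i, r)"
      have "(\<integral>\<^sup>+ y. g y * 1 \<partial>cgauss) \<le> (\<integral>\<^sup>+ y. g y * ennreal (exp ((cmod y)\<^sup>2 / 4)) \<partial>cgauss)"
        by (intro nn_integral_mono mult_left_mono) (auto simp: ennreal_ge_1)
      also have "\<dots> \<le> ennreal (s\<^sup>2 * exp (2 * (cmod ?b)\<^sup>2 / s\<^sup>2)) * (\<integral>\<^sup>+ y. g (of_real s * y + ?b) \<partial>cgauss)"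
        by (rule cgauss_affine_bound[OF g s])
      also have "\<dots> \<le> ennreal (s\<^sup>2 * exp ((cmod (x (fst i, r)))\<^sup>2 / 4)) * (\<integral>\<^sup>+ y. g (of_real s * y + ?b) \<partial>cgauss)"
      proof (intro mult_right_mono ennreal_leI mult_left_mono)
        have "8 * (cmod (\<rho> (fst i)))\<^sup>2 * (cmod (x (fst i, r)))\<^sup>2 \<le> s\<^sup>2 * (cmod (x (fst i, r)))\<^sup>2"
          using \<rho>[of "fst i"] i by (intro mult_right_mono) (auto simp: I2_def)
        then show "exp (2 * (cmod ?b)\<^sup>2 / s\<^sup>2) \<le> exp ((cmod (x (fst i, r)))\<^sup>2 / 4)"
          using s by (simp add: norm_mult power_mult_distrib field_simps)
      qed auto
      finally show "(\<integral>\<^sup>+ y. g y * 1 \<partial>cgauss)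
          \<le> ennreal (s\<^sup>2 * exp ((cmod (x (fst i, r)))\<^sup>2 / 4)) * (\<integral>\<^sup>+ y. g (T2 x i y) \<partial>cgauss)"
        by (simp add: T2_def)
    qed (use Fm in \<open>auto simp: T2_def measurable_cong_sets[OF sets_cgauss sets_cgauss]\<close>)
    also have "(\<Prod>i\<in>I2. ennreal (s\<^sup>2 * exp ((cmod (x (fst i, r)))\<^sup>2 / 4)))
        = (\<Prod>n<N. ennreal (s\<^sup>2)) * (\<Prod>n<N. ennreal (exp ((cmod (x (n, r)))\<^sup>2 / 4)))"
      unfolding I2_def prod.distrib[symmetric]
      by (rule prod.reindex_cong[of "\<lambda>n. (n, r')"]) (auto simp: inj_on_def ennreal_mult)
    also have "(\<Prod>n<N. ennreal (exp ((cmod (x (n, r)))\<^sup>2 / 4))) = (\<Prod>i\<in>I1. w1 i (x i))"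
    proof -
      have "(\<Prod>i\<in>I1. w1 i (x i)) = (\<Prod>i\<in>I1. if snd i = r then ennreal (exp ((cmod (x (fst i, r)))\<^sup>2 / 4)) else 1)"
        by (intro prod.cong) (auto simp: w1_def)
      also have "\<dots> = (\<Prod>n<N. ennreal (exp ((cmod (x (n, r)))\<^sup>2 / 4)))"
        unfolding I1_def by (rule prod_rx_if) (use rr in auto)
      finally show ?thesis by simp
    qed
    finally show ?thesis by (simp add: ac_simps ennreal_power)
  qed
  have "(\<integral>\<^sup>+ z. F z \<partial>noise_space N)
      = (\<integral>\<^sup>+ x. \<integral>\<^sup>+ y. F (merge I1 I2 (x, y)) \<partial>PiM I2 (\<lambda>_. cgauss) \<partial>PiM I1 (\<lambda>_. cgauss))"
    unfolding noise by (rule product_nn_integral_fold[OF disj fin F'])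
  also have "\<dots> \<le> (\<integral>\<^sup>+ x. ennreal ((s\<^sup>2) ^ N) * (H x * (\<Prod>i\<in>I1. w1 i (x i))) \<partial>PiM I1 (\<lambda>_. cgauss))"
    by (intro nn_integral_mono inner)
  also have "\<dots> = ennreal ((s\<^sup>2) ^ N) * (\<integral>\<^sup>+ x. H x * (\<Prod>i\<in>I1. w1 i (x i)) \<partial>PiM I1 (\<lambda>_. cgauss))"
    by (rule nn_integral_cmult)
      (intro borel_measurable_times_ennreal mH borel_measurable_prod_ennreal measurable_compose[OF comp1],
       auto simp: w1_def)
  also have "\<dots> \<le> ennreal ((s\<^sup>2) ^ N) * ((\<Prod>i\<in>I1. k1 i) * (\<integral>\<^sup>+ x. H (\<lambda>i\<in>I1. T1 i (x i)) \<partial>PiM I1 (\<lambda>_. cgauss)))"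
  proof (intro mult_left_mono nn_integral_PiM_bound mH)
    fix i and g :: "complex \<Rightarrow> ennreal" assume i: "i \<in> I1" and "g \<in> borel_measurable cgauss"
    then have g [measurable]: "g \<in> borel_measurable borel" by simp
    show "(\<integral>\<^sup>+ y. g y * w1 i y \<partial>cgauss) \<le> k1 i * (\<integral>\<^sup>+ y. g (T1 i y) \<partial>cgauss)"
      using cgauss_affine_bound[OF g a, of "- f (fst i)"]
      by (auto simp: w1_def k1_def T1_def)
  qed (auto simp: w1_def T1_def measurable_cong_sets[OF sets_cgauss sets_cgauss])
  also have "(\<integral>\<^sup>+ x. H (\<lambda>i\<in>I1. T1 i (x i)) \<partial>PiM I1 (\<lambda>_. cgauss))
      = (\<integral>\<^sup>+ x. \<integral>\<^sup>+ y. F (retarget N r r' f a \<rho> s (merge I1 I2 (x, y))) \<partial>PiM I2 (\<lambda>_. cgauss) \<partial>PiM I1 (\<lambda>_. cgauss))"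
    unfolding H_def
  proof (intro nn_integral_cong arg_cong[where f = F] ext)
    fix x y i
    show "merge I1 I2 (\<lambda>i\<in>I1. T1 i (x i), \<lambda>i\<in>I2. T2 (\<lambda>i\<in>I1. T1 i (x i)) i (y i)) i
        = retarget N r r' f a \<rho> s (merge I1 I2 (x, y)) i"
      using rr by (cases i) (auto simp: retarget_def merge_def T1_def T2_def I1_def I2_def)
  qed
  also have "\<dots> = (\<integral>\<^sup>+ \<zeta>. F (retarget N r r' f a \<rho> s \<zeta>) \<partial>noise_space N)"
    unfolding noise
    by (rule product_nn_integral_fold[OF disj fin, symmetric])
      (rule measurable_compose[OF measurable_retarget[of N r r' f a \<rho> s, unfolded noise] F'])
  also have "(\<Prod>i\<in>I1. k1 i) = ennreal ((a\<^sup>2) ^ N * exp (2 * (\<Sum>n<N. (cmod (f n))\<^sup>2) / a\<^sup>2))"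
  proof -
    have "(\<Prod>i\<in>I1. k1 i) = (\<Prod>n<N. ennreal (a\<^sup>2 * exp (2 * (cmod (f n))\<^sup>2 / a\<^sup>2)))"
      unfolding I1_def k1_def by (rule prod_rx_if) (use rr in auto)
    also have "\<dots> = ennreal (\<Prod>n<N. a\<^sup>2 * exp (2 * (cmod (f n))\<^sup>2 / a\<^sup>2))"
      by (rule prod_ennreal) auto
    also have "(\<Prod>n<N. a\<^sup>2 * exp (2 * (cmod (f n))\<^sup>2 / a\<^sup>2)) = (a\<^sup>2) ^ N * exp (2 * (\<Sum>n<N. (cmod (f n))\<^sup>2) / a\<^sup>2)"
      by (simp add: prod.distrib exp_sum sum_distrib_left sum_divide_distrib)
    finally show ?thesis .
  qed
  finally show ?thesis
    by (simp add: ennreal_mult[symmetric] mult.assoc[symmetric] power_mult_distrib)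
qed

subsection \<open>The probability space\<close>

lemma prob_space_noise: "prob_space (noise_space N)"
  unfolding noise_space_def by (intro prob_space_PiM prob_space_cgauss)

lemma prob_space_msg: "prob_space (msg_space M)"
  unfolding msg_space_def by (intro prob_space_PiM prob_space_measure_pmf)

lemma prob_space_fade:
  assumes "admissible_fading \<nu> hmin hmax" shows "prob_space (fade_space N \<nu>)"
  using assms unfolding fade_space_def admissible_fading_def by (intro prob_space_PiM) auto

lemma prob_space_Omega:
  assumes "admissible_fading \<nu> hmin hmax" shows "prob_space (Omega M N \<nu>)"
proof -
  interpret A: prob_space "msg_space M" by (rule prob_space_msg)
  interpret B: prob_space "fade_space N \<nu>" by (rule prob_space_fade[OF assms])
  interpret C: prob_space "noise_space N" by (rule prob_space_noise)
  interpret BC: pair_prob_space "fade_space N \<nu>" "noise_space N" ..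
  interpret ABC: pair_prob_space "msg_space M" "fade_space N \<nu> \<Otimes>\<^sub>M noise_space N" ..
  show ?thesis unfolding Omega_def by (rule ABC.prob_space_axioms)
qed

lemma measurable_fade_component:
  assumes "admissible_fading \<nu> hmin hmax" "b < N"
  shows "(\<lambda>g. g b l) \<in> borel_measurable (fade_space N \<nu>)"
proof -
  have "(\<lambda>g. g b l) \<in> measurable (fade_space N \<nu>) (\<nu> l)"
    unfolding fade_space_def
    by (rule measurable_compose[OF measurable_component_singleton[of b] measurable_component_singleton[of l]])
      (use assms in auto)
  moreover have "sets (\<nu> l) = sets borel"
    using assms unfolding admissible_fading_def by blast
  ultimately show ?thesis
    using measurable_cong_sets[OF refl, of "\<nu> l" borel "fade_space N \<nu>"] by blast
qed

lemma measurable_Omega_fade: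
  assumes "admissible_fading \<nu> hmin hmax" "b < N"
  shows "(\<lambda>(w, g, z). g b l) \<in> borel_measurable (Omega M N \<nu>)"
  unfolding Omega_def case_prod_beta'
  by (rule measurable_compose[OF _ measurable_fade_component[OF assms]]) simp

lemma measurable_Omega_noise:
  assumes "n < N"
  shows "(\<lambda>(w, g, z). z (n, r)) \<in> borel_measurable (Omega M N \<nu>)"
proof -
  have "(\<lambda>z. z (n, r)) \<in> borel_measurable (noise_space N)"
    using measurable_component_singleton[of "(n, r)" "{..<N} \<times> UNIV" "\<lambda>_. cgauss"] assms
    by (simp add: noise_space_def measurable_cong_sets[OF refl sets_cgauss])
  then show ?thesis
    unfolding Omega_def case_prod_beta' by (rule measurable_compose[rotated]) simp
qed

lemma measurable_Omega_msg:
  "(\<lambda>(w, g, z). w t) \<in> measurable (Omega M N \<nu>) (count_space UNIV)"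
proof -
  have "(\<lambda>w. w t) \<in> measurable (msg_space M) (measure_pmf (pmf_of_set {..<M t}))"
    unfolding msg_space_def by (rule measurable_component_singleton) simp
  then have "(\<lambda>w. w t) \<in> measurable (msg_space M) (count_space UNIV)" by simp
  then show ?thesis
    unfolding Omega_def case_prod_beta' by (rule measurable_compose[rotated]) simp
qed

lemma AE_fade_bounds:
  assumes "admissible_fading \<nu> hmin hmax"
  shows "AE g in fade_space N \<nu>. \<forall>b<N. \<forall>l. hmin \<le> cmod (g b l) \<and> cmod (g b l) \<le> hmax"
proof -
  have P: "\<And>l. prob_space (\<nu> l)" and h: "\<And>l. AE h in \<nu> l. hmin \<le> cmod h \<and> cmod h \<le> hmax"
    using assms by (auto simp: admissible_fading_def)
  have "AE g in fade_space N \<nu>. hmin \<le> cmod (g b l) \<and> cmod (g b l) \<le> hmax" if "b < N" for b l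
  proof -
    have "AE x in PiM UNIV \<nu>. hmin \<le> cmod (x l) \<and> cmod (x l) \<le> hmax"
      by (rule AE_PiM_component) (use P h in auto)
    then show ?thesis
      unfolding fade_space_def
      by (intro AE_PiM_component[where P = "\<lambda>x. hmin \<le> cmod (x l) \<and> cmod (x l) \<le> hmax"])
        (use that P in \<open>auto intro: prob_space_PiM\<close>)
  qed
  then have "AE g in fade_space N \<nu>. \<forall>p\<in>{..<N} \<times> UNIV. hmin \<le> cmod (g (fst p) (snd p)) \<and> cmod (g (fst p) (snd p)) \<le> hmax"
    by (intro AE_finite_allI) (auto simp: finite_Prod_UNIV)
  then show ?thesis by eventually_elim auto
qed

lemma AE_pair_fst:
  assumes "sigma_finite_measure B" "AE x in A. Q x"
  shows "AE p in A \<Otimes>\<^sub>M B. Q (fst p)"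
proof -
  interpret B: sigma_finite_measure B by fact
  obtain N where N: "{x \<in> space A. \<not> Q x} \<subseteq> N" "N \<in> null_sets A"
    using assms(2) by (auto elim: AE_E2 simp: eventually_ae_filter)
  then have "N \<times> space B \<in> null_sets (A \<Otimes>\<^sub>M B)"
    by (auto simp: null_sets_def B.emeasure_pair_measure_Times)
  then show ?thesis
    by (rule AE_I') (use N in \<open>auto simp: space_pair_measure\<close>)
qed

lemma AE_pair_snd:
  assumes "sigma_finite_measure B" "AE x in B. Q x"
  shows "AE p in A \<Otimes>\<^sub>M B. Q (snd p)"
proof -
  interpret B: sigma_finite_measure B by fact
  obtain N where N: "{x \<in> space B. \<not> Q x} \<subseteq> N" "N \<in> null_sets B"
    using assms(2) by (auto simp: eventually_ae_filter)
  then have "space A \<times> N \<in> null_sets (A \<Otimes>\<^sub>M B)"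
    by (auto simp: null_sets_def B.emeasure_pair_measure_Times)
  then show ?thesis
    by (rule AE_I') (use N in \<open>auto simp: space_pair_measure\<close>)
qed

lemma AE_Omega_fade:
  assumes adm: "admissible_fading \<nu> hmin hmax" and Q: "AE g in fade_space N \<nu>. Q g"
  shows "AE \<omega> in Omega M N \<nu>. case \<omega> of (w, g, z) \<Rightarrow> Q g"
proof -
  interpret B: prob_space "fade_space N \<nu>" by (rule prob_space_fade[OF adm])
  interpret C: prob_space "noise_space N" by (rule prob_space_noise)
  interpret BC: pair_prob_space "fade_space N \<nu>" "noise_space N" ..
  have "AE \<omega> in Omega M N \<nu>. Q (fst (snd \<omega>))"
    unfolding Omega_def
    by (rule AE_pair_snd[OF BC.sigma_finite_measure_axioms AE_pair_fst[OF C.sigma_finite_measure_axioms Q]])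
  then show ?thesis by (simp add: case_prod_beta')
qed

text \<open>The space consists of all functions into the naturals, but its mass is spread evenly
  over a finite box. Writing the expectation as a sum makes the counting of decodable tuples
  applicable.\<close>

lemma nn_integral_msg_space:
  assumes M: "\<And>t. 1 \<le> M t" and F: "F \<in> borel_measurable (msg_space M)"
  shows "(\<integral>\<^sup>+ w. F w \<partial>msg_space M)
    = ennreal (1 / (\<Prod>t\<in>UNIV. real (M t))) * (\<Sum>w\<in>(\<Pi>\<^sub>E t\<in>UNIV. {..<M t}). F w)"
proof -
  let ?W = "\<Pi>\<^sub>E t\<in>UNIV. {..<M t}"
  let ?\<mu> = "\<lambda>t. measure_pmf (pmf_of_set {..<M t})"
  interpret product_prob_space ?\<mu> UNIV
    by unfold_locales (rule prob_space.emeasure_space_1[OF prob_space_measure_pmf])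
  interpret prob_space "msg_space M" by (rule prob_space_msg)
  have ne: "{..<M t} \<noteq> {}" for t using M[of t] by (auto simp: lessThan_empty_iff)
  have em: "emeasure (msg_space M) (PiE UNIV B) = (\<Prod>t\<in>UNIV. emeasure (?\<mu> t) (B t))" for B
    unfolding msg_space_def by (rule emeasure_PiM) auto
  have ms: "PiE UNIV B \<in> sets (msg_space M)" for B
    unfolding msg_space_def by (rule sets_PiM_I_finite) auto
  have sing: "{v} = (\<Pi>\<^sub>E t\<in>UNIV. {v t})" for v :: "tx \<Rightarrow> nat"
    by (auto simp: PiE_iff fun_eq_iff)
  have ev: "emeasure (msg_space M) {v} = ennreal (1 / (\<Prod>t\<in>UNIV. real (M t)))" if "v \<in> ?W" for v
  proof -
    have "emeasure (?\<mu> t) {v t} = ennreal (1 / real (M t))" for t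
      using that ne[of t] by (auto simp: emeasure_pmf_single PiE_iff)
    then have "emeasure (msg_space M) {v} = (\<Prod>t\<in>UNIV. ennreal (1 / real (M t)))"
      by (subst sing) (simp add: em)
    also have "\<dots> = ennreal (\<Prod>t\<in>UNIV. 1 / real (M t))" by (rule prod_ennreal) auto
    finally show ?thesis by (simp add: prod_dividef)
  qed
  have "emeasure (?\<mu> t) {..<M t} = 1" for t
    using ne[of t] by (simp add: emeasure_pmf_of_set)
  then have "prob ?W = 1" by (simp add: em measure_def)
  then have AEW: "AE w in msg_space M. w \<in> ?W" by (rule AE_prob_1)
  have fin: "finite ?W" by (rule finite_PiE) auto
  have "(\<integral>\<^sup>+ w. F w \<partial>msg_space M) = (\<integral>\<^sup>+ w. (\<Sum>v\<in>?W. F v * indicator {v} w) \<partial>msg_space M)"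
  proof (rule nn_integral_cong_AE, use AEW in eventually_elim)
    fix w assume "w \<in> ?W"
    then show "F w = (\<Sum>v\<in>?W. F v * indicator {v} w)"
      using fin by (simp add: indicator_def if_distrib[of "\<lambda>x. _ * x"] cong: if_cong)
  qed
  also have "\<dots> = (\<Sum>v\<in>?W. F v * emeasure (msg_space M) {v})"
    using ms by (subst nn_integral_sum) (auto simp: sing nn_integral_cmult_indicator)
  also have "\<dots> = (\<Sum>v\<in>?W. ennreal (1 / (\<Prod>t\<in>UNIV. real (M t))) * F v)"
    by (rule sum.cong[OF refl]) (simp only: ev mult.commute)
  finally show ?thesis by (simp only: sum_distrib_left)
qed

subsection \<open>Converse\<close>

definition noiseless :: "csit \<Rightarrow> nat \<Rightarrow> encoder \<Rightarrow> (tx \<Rightarrow> nat) \<Rightarrow> (nat \<Rightarrow> rx \<times> tx \<Rightarrow> complex)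
    \<Rightarrow> rx \<Rightarrow> nat \<Rightarrow> complex" where
  "noiseless s \<tau> enc w g r n = (\<Sum>t\<in>hears r. chan \<tau> g n r t * tx_sig s enc w g t n)"

lemma rx_sig_eq: "rx_sig s \<tau> enc w g z r n = noiseless s \<tau> enc w g r n + z (n, r)"
proof -
  have "(\<Sum>t\<in>UNIV. if conn r t then chan \<tau> g n r t * tx_sig s enc w g t n else 0)
      = (\<Sum>t\<in>UNIV \<inter> hears r. chan \<tau> g n r t * tx_sig s enc w g t n)"
    unfolding conn_def by (rule sum.inter_restrict[symmetric]) simp
  then show ?thesis by (simp add: rx_sig_def noiseless_def)
qed

lemma conn_dest: "conn (dest t) t"
  by (cases t) (auto simp: conn_def)

text \<open>After retargeting, \<open>r\<close> determines its own messages from \<open>\<zeta>\<close> alone, whereupon the signal at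
  \<open>dest t\<close> is known up to contributions of messages outside \<open>insert t {x. dest x = r}\<close>.\<close>
lemma card_jointly_decodable:
  fixes dec :: decoder and g :: "nat \<Rightarrow> rx \<times> tx \<Rightarrow> complex" and \<zeta> :: "nat \<times> rx \<Rightarrow> complex" and \<tau> :: nat
  assumes rt: "conn r t" "dest t \<noteq> r" and nz: "\<And>n. n < N \<Longrightarrow> chan \<tau> g n r t \<noteq> 0"
  defines "T \<equiv> insert t {x. dest x = r}"
    and "\<rho> \<equiv> \<lambda>n. chan \<tau> g n (dest t) t / chan \<tau> g n r t"
  shows "card {w \<in> (\<Pi>\<^sub>E x\<in>UNIV. {..<M x}). \<forall>x. estimate s \<tau> N enc dec w g
            (retarget N r (dest t) (noiseless s \<tau> enc w g r) a \<rho> \<sigma> \<zeta>) x = w x}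
    \<le> (\<Prod>x\<in>-T. M x)" (is "card ?A \<le> _")
proof -
  let ?z = "\<lambda>w. retarget N r (dest t) (noiseless s \<tau> enc w g r) a \<rho> \<sigma> \<zeta>"
  \<comment> \<open>The retargeted noise subtracts the noiseless signal at \<open>r\<close>, so the
    observation is the same for every \<open>w\<close>.\<close>
  have yr: "rx_sig s \<tau> enc w g (?z w) r n = of_real a * \<zeta> (n, r)" if "n < N" for w n
    using that by (simp add: rx_sig_eq retarget_def)
  have "inj_on (\<lambda>w. restrict w (-T)) ?A"
  proof (rule inj_onI)
    fix v w assume v: "v \<in> ?A" and w: "w \<in> ?A" and eq: "restrict v (-T) = restrict w (-T)"
    have off: "v x = w x" if "x \<notin> T" for x
      using fun_cong[OF eq, of x] that by simp
    have own: "v x = w x" if x: "dest x = r" for x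
    proof -
      have "estimate s \<tau> N enc dec v g (?z v) x = estimate s \<tau> N enc dec w g (?z w) x"
        unfolding estimate_def x
        by (rule arg_cong[where f = "\<lambda>y. dec r y _ x"]) (auto simp: yr)
      then show ?thesis using v w by simp
    qed
    have others: "v x = w x" if "x \<noteq> t" for x
      using off[of x] own[of x] that by (auto simp: T_def)
    \<comment> \<open>A transmitted signal depends on its own message and possibly on
      \<open>g\<close>, which both tuples share. Hence the argument covers perfect CSIT as
      well.\<close>
    have sig: "tx_sig s enc v g x n = tx_sig s enc w g x n" if "x \<noteq> t" for x n
      by (simp add: tx_sig_def others[OF that])
    have "rx_sig s \<tau> enc v g (?z v) (dest t) n = rx_sig s \<tau> enc w g (?z w) (dest t) n" if n: "n < N" for n
    proof -
      have split: "noiseless s \<tau> enc u g q n = chan \<tau> g n q t * tx_sig s enc u g t n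
          + (\<Sum>x\<in>hears q - {t}. chan \<tau> g n q x * tx_sig s enc u g x n)" if "conn q t" for u q
        unfolding noiseless_def using that by (intro sum.remove) (auto simp: conn_def)
      have rest: "(\<Sum>x\<in>hears q - {t}. chan \<tau> g n q x * tx_sig s enc v g x n)
          = (\<Sum>x\<in>hears q - {t}. chan \<tau> g n q x * tx_sig s enc w g x n)" for q
        by (intro sum.cong) (auto simp: sig)
      \<comment> \<open>The ratio \<open>\<rho>\<close> is chosen so that the contribution of
        \<open>t\<close> cancels in this combination; all remaining signals already agree. The noise
        at \<open>dest t\<close> was retargeted so that its observation depends on \<open>w\<close>
        only through this combination.\<close>
      have "noiseless s \<tau> enc v g (dest t) n - \<rho> n * noiseless s \<tau> enc v g r n
          = noiseless s \<tau> enc w g (dest t) n - \<rho> n * noiseless s \<tau> enc w g r n"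
        using nz[OF n] by (simp add: split[OF rt(1)] split[OF conn_dest] rest \<rho>_def algebra_simps)
      then show ?thesis
        using n rt by (simp add: rx_sig_eq retarget_def algebra_simps)
    qed
    then have "estimate s \<tau> N enc dec v g (?z v) t = estimate s \<tau> N enc dec w g (?z w) t"
      unfolding estimate_def
      by (intro arg_cong[where f = "\<lambda>y. dec (dest t) y _ t"]) auto
    then have "v t = w t" using v w by simp
    with others show "v = w" by (metis ext)
  qed
  moreover have "(\<lambda>w. restrict w (-T)) ` ?A \<subseteq> (\<Pi>\<^sub>E x\<in>-T. {..<M x})"
    by (auto simp: PiE_iff)
  ultimately have "card ?A \<le> card (\<Pi>\<^sub>E x\<in>-T. {..<M x})"
    by (intro card_inj_on_le[of "\<lambda>w. restrict w (-T)"] finite_PiE) auto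
  then show ?thesis by (simp add: card_PiE)
qed

section \<open>Typical received energy\<close>

lemma measurable_Omega_noiseless:
  assumes adm: "admissible_fading \<nu> hmin hmax" and n: "n < N"
    and X: "\<And>t. (\<lambda>(w, g, z). tx_sig s enc w g t n) \<in> borel_measurable (Omega M N \<nu>)"
  shows "(\<lambda>(w, g, z). noiseless s \<tau> enc w g r n) \<in> borel_measurable (Omega M N \<nu>)"
proof -
  have "n div \<tau> < N" using n by (rule le_less_trans[OF div_le_dividend])
  then have "(\<lambda>(w, g, z). chan \<tau> g n r t) \<in> borel_measurable (Omega M N \<nu>)" for t
    unfolding chan_def by (rule measurable_Omega_fade[OF adm])
  then show ?thesis
    using X unfolding noiseless_def case_prod_beta'
    by (intro borel_measurable_sum borel_measurable_times) auto
qed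

lemma cmod_noiseless_le:
  assumes "\<And>t. cmod (chan \<tau> g n r t) \<le> h"
  shows "(cmod (noiseless s \<tau> enc w g r n))\<^sup>2 \<le> 4 * h\<^sup>2 * (\<Sum>t\<in>hears r. (cmod (tx_sig s enc w g t n))\<^sup>2)"
proof -
  have h: "0 \<le> h" using assms norm_ge_zero order_trans by blast
  have card: "card (hears r) = 4" by (cases r) auto
  let ?S = "\<Sum>t\<in>hears r. cmod (tx_sig s enc w g t n)"
  have "cmod (noiseless s \<tau> enc w g r n) \<le> (\<Sum>t\<in>hears r. h * cmod (tx_sig s enc w g t n))"
    unfolding noiseless_def
    by (rule sum_norm_le) (auto simp: norm_mult intro!: mult_right_mono assms)
  also have "\<dots> = h * ?S" by (simp add: sum_distrib_left)
  finally have "(cmod (noiseless s \<tau> enc w g r n))\<^sup>2 \<le> (h * ?S)\<^sup>2"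
    by (intro power_mono) auto
  also have "\<dots> = h\<^sup>2 * ?S\<^sup>2" by (simp add: power_mult_distrib)
  also have "\<dots> \<le> h\<^sup>2 * ((\<Sum>t\<in>hears r. (cmod (tx_sig s enc w g t n))\<^sup>2) * 4)"
    using sum_squared_le_sum_of_squares[of "\<lambda>t. cmod (tx_sig s enc w g t n)" "hears r"] card
    by (intro mult_left_mono) auto
  finally show ?thesis by (simp add: ac_simps)
qed

text \<open>The price of retargeting is exponential in the received energy divided by
  \<open>P\<close>, while the power constraint holds only on average. Markov's inequality confines
  the change of measure to messages and fading with energy of order \<open>N * P\<close>.\<close>

lemma prob_received_power:
  fixes r :: rx
  assumes adm: "admissible_fading \<nu> hmin hmax" and good: "good_code s \<tau> \<nu> P N M enc dec \<epsilon>"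
    and P: "0 < P" and N: "0 < N"
  defines "u \<equiv> \<lambda>w g. \<Sum>n<N. (cmod (noiseless s \<tau> enc w g r n))\<^sup>2"
  shows "{\<omega> \<in> space (Omega M N \<nu>). case \<omega> of (w, g, z) \<Rightarrow> u w g \<le> 64 * hmax\<^sup>2 * N * P} \<in> sets (Omega M N \<nu>)"
    and "3/4 \<le> measure (Omega M N \<nu>)
      {\<omega> \<in> space (Omega M N \<nu>). case \<omega> of (w, g, z) \<Rightarrow> u w g \<le> 64 * hmax\<^sup>2 * N * P}"
proof -
  let ?O = "Omega M N \<nu>"
  interpret O: prob_space ?O by (rule prob_space_Omega[OF adm])
  have hmax: "0 < hmax" using adm by (auto simp: admissible_fading_def)
  have X: "(\<lambda>(w, g, z). tx_sig s enc w g t n) \<in> borel_measurable ?O"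
    and pow: "(\<integral>\<^sup>+ \<omega>. ennreal ((cmod (case \<omega> of (w, g, z) \<Rightarrow> tx_sig s enc w g t n))\<^sup>2) \<partial>?O) \<le> ennreal P"
    if "n < N" for t n
    using good that by (auto simp: good_code_def)
  have f: "(\<lambda>(w, g, z). noiseless s \<tau> enc w g r n) \<in> borel_measurable ?O" if "n < N" for n
    by (rule measurable_Omega_noiseless[OF adm that X[OF that]])
  have u [measurable]: "(\<lambda>(w, g, z). u w g) \<in> borel_measurable ?O"
    using f unfolding u_def case_prod_beta'
    by (intro borel_measurable_sum borel_measurable_power borel_measurable_norm measurable_compose[OF f]) auto
  \<comment> \<open>The mean energy is at most a quarter of this: Cauchy-Schwarz over the four heard
    signals gives a factor 4, and their four powers add up to at most \<open>4 * P\<close>. Markov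
    then leaves probability at most 1/4 outside.\<close>
  let ?c = "64 * hmax\<^sup>2 * N * P"
  have c: "0 < ?c" using hmax P N by simp
  let ?G = "{\<omega> \<in> space ?O. case \<omega> of (w, g, z) \<Rightarrow> u w g \<le> ?c}"
  show G: "?G \<in> sets ?O" using u by (simp add: case_prod_beta')
  have "(\<integral>\<^sup>+ \<omega>. ennreal ((cmod (case \<omega> of (w, g, z) \<Rightarrow> noiseless s \<tau> enc w g r n))\<^sup>2) \<partial>?O) \<le> ennreal (16 * hmax\<^sup>2 * P)"
    if n: "n < N" for n
  proof -
    have "AE g in fade_space N \<nu>. \<forall>t. cmod (chan \<tau> g n r t) \<le> hmax"
      using AE_fade_bounds[OF adm, of N]
      by eventually_elim (use n le_less_trans[OF div_le_dividend n] in \<open>auto simp: chan_def\<close>)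
    from AE_Omega_fade[OF adm this, of M]
    have "AE \<omega> in ?O. ennreal ((cmod (case \<omega> of (w, g, z) \<Rightarrow> noiseless s \<tau> enc w g r n))\<^sup>2)
        \<le> ennreal (4 * hmax\<^sup>2) * (\<Sum>t\<in>hears r. ennreal ((cmod (case \<omega> of (w, g, z) \<Rightarrow> tx_sig s enc w g t n))\<^sup>2))"
    proof eventually_elim
      fix \<omega> :: "(tx \<Rightarrow> nat) \<times> (nat \<Rightarrow> rx \<times> tx \<Rightarrow> complex) \<times> (nat \<times> rx \<Rightarrow> complex)"
      assume "case \<omega> of (w, g, z) \<Rightarrow> \<forall>t. cmod (chan \<tau> g n r t) \<le> hmax"
      then show "ennreal ((cmod (case \<omega> of (w, g, z) \<Rightarrow> noiseless s \<tau> enc w g r n))\<^sup>2)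
        \<le> ennreal (4 * hmax\<^sup>2) * (\<Sum>t\<in>hears r. ennreal ((cmod (case \<omega> of (w, g, z) \<Rightarrow> tx_sig s enc w g t n))\<^sup>2))"
        using cmod_noiseless_le[of \<tau> "fst (snd \<omega>)" n r hmax s enc "fst \<omega>"]
        by (auto simp: case_prod_beta' sum_ennreal simp flip: ennreal_mult' intro!: ennreal_leI)
    qed
    then have "(\<integral>\<^sup>+ \<omega>. ennreal ((cmod (case \<omega> of (w, g, z) \<Rightarrow> noiseless s \<tau> enc w g r n))\<^sup>2) \<partial>?O)
        \<le> (\<integral>\<^sup>+ \<omega>. ennreal (4 * hmax\<^sup>2) * (\<Sum>t\<in>hears r. ennreal ((cmod (case \<omega> of (w, g, z) \<Rightarrow> tx_sig s enc w g t n))\<^sup>2)) \<partial>?O)"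
      by (rule nn_integral_mono_AE)
    also have "\<dots> = ennreal (4 * hmax\<^sup>2) * (\<Sum>t\<in>hears r. \<integral>\<^sup>+ \<omega>. ennreal ((cmod (case \<omega> of (w, g, z) \<Rightarrow> tx_sig s enc w g t n))\<^sup>2) \<partial>?O)"
    proof -
      have [measurable]: "(\<lambda>\<omega>. ennreal ((cmod (case \<omega> of (w, g, z) \<Rightarrow> tx_sig s enc w g t n))\<^sup>2)) \<in> borel_measurable ?O" for t
        by (rule measurable_compose[OF X[OF n]]) auto
      have [measurable]: "(\<lambda>\<omega>. (cmod (case \<omega> of (w, g, z) \<Rightarrow> tx_sig s enc w g t n))\<^sup>2) \<in> borel_measurable ?O" for t
        by (rule measurable_compose[OF X[OF n]]) auto
      show ?thesis
        by (subst nn_integral_cmult) (auto simp del: sum_ennreal intro!: arg_cong2[where f = times] nn_integral_sum)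
    qed
    also have "\<dots> \<le> ennreal (4 * hmax\<^sup>2) * (\<Sum>t\<in>hears r. ennreal P)"
      by (intro mult_left_mono sum_mono pow n) auto
    also have "\<dots> = ennreal (16 * hmax\<^sup>2 * P)"
    proof -
      have "card (hears r) = 4" by (cases r) auto
      then have "(\<Sum>t\<in>hears r. ennreal P) = ennreal (4 * P)"
        using P by (simp add: ennreal_mult flip: ennreal_numeral)
      then show ?thesis using P by (simp flip: ennreal_mult')
    qed
    finally show ?thesis .
  qed
  then have "(\<Sum>n<N. \<integral>\<^sup>+ \<omega>. ennreal ((cmod (case \<omega> of (w, g, z) \<Rightarrow> noiseless s \<tau> enc w g r n))\<^sup>2) \<partial>?O)
      \<le> (\<Sum>n<N. ennreal (16 * hmax\<^sup>2 * P))"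
    by (intro sum_mono) auto
  also have "\<dots> = ennreal (?c / 4)"
    using P by (simp add: sum_ennreal del: sum_constant) (simp add: ac_simps)
  also have "(\<Sum>n<N. \<integral>\<^sup>+ \<omega>. ennreal ((cmod (case \<omega> of (w, g, z) \<Rightarrow> noiseless s \<tau> enc w g r n))\<^sup>2) \<partial>?O)
      = (\<integral>\<^sup>+ \<omega>. ennreal (case \<omega> of (w, g, z) \<Rightarrow> u w g) \<partial>?O)"
  proof -
    have "(\<lambda>\<omega>. ennreal ((cmod (case \<omega> of (w, g, z) \<Rightarrow> noiseless s \<tau> enc w g r n))\<^sup>2)) \<in> borel_measurable ?O" if "n < N" for n
      by (rule measurable_compose[OF f[OF that]]) auto
    then show ?thesis
      by (subst nn_integral_sum[symmetric]) (auto simp: u_def case_prod_beta' sum_ennreal)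
  qed
  finally have tot: "(\<integral>\<^sup>+ \<omega>. ennreal (case \<omega> of (w, g, z) \<Rightarrow> u w g) \<partial>?O) \<le> ennreal (?c / 4)" .
  have "emeasure ?O {\<omega> \<in> space ?O. 1 \<le> ennreal (1 / ?c) * ennreal (case \<omega> of (w, g, z) \<Rightarrow> u w g)}
      \<le> ennreal (1 / ?c) * (\<integral>\<^sup>+ \<omega>. ennreal (case \<omega> of (w, g, z) \<Rightarrow> u w g) * indicator (space ?O) \<omega> \<partial>?O)"
    by (rule nn_integral_Markov_inequality) measurable
  also have "(\<integral>\<^sup>+ \<omega>. ennreal (case \<omega> of (w, g, z) \<Rightarrow> u w g) * indicator (space ?O) \<omega> \<partial>?O)
      = (\<integral>\<^sup>+ \<omega>. ennreal (case \<omega> of (w, g, z) \<Rightarrow> u w g) \<partial>?O)"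
    by (intro nn_integral_cong) simp
  also have "ennreal (1 / ?c) * \<dots> \<le> ennreal (1 / ?c) * ennreal (?c / 4)"
    by (intro mult_left_mono tot) auto
  also have "\<dots> = ennreal (1 / 4)" using P N hmax by (simp flip: ennreal_mult')
  finally have "emeasure ?O {\<omega> \<in> space ?O. 1 \<le> ennreal (1 / ?c) * ennreal (case \<omega> of (w, g, z) \<Rightarrow> u w g)} \<le> ennreal (1 / 4)" .
  moreover have "space ?O - ?G \<subseteq> {\<omega> \<in> space ?O. 1 \<le> ennreal (1 / ?c) * ennreal (case \<omega> of (w, g, z) \<Rightarrow> u w g)}"
  proof
    fix \<omega> assume \<omega>: "\<omega> \<in> space ?O - ?G"
    then have "?c < (case \<omega> of (w, g, z) \<Rightarrow> u w g)" by (auto simp: case_prod_beta')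
    then have "1 \<le> 1 / ?c * (case \<omega> of (w, g, z) \<Rightarrow> u w g)" using c by (simp add: field_simps)
    then show "\<omega> \<in> {\<omega> \<in> space ?O. 1 \<le> ennreal (1 / ?c) * ennreal (case \<omega> of (w, g, z) \<Rightarrow> u w g)}"
      using \<omega> c by (simp flip: ennreal_mult' add: ennreal_ge_1)
  qed
  moreover have "{\<omega> \<in> space ?O. 1 \<le> ennreal (1 / ?c) * ennreal (case \<omega> of (w, g, z) \<Rightarrow> u w g)} \<in> sets ?O"
    by measurable
  ultimately have "emeasure ?O (space ?O - ?G) \<le> ennreal (1 / 4)"
    using emeasure_mono by (meson order_trans)
  then have "O.prob (space ?O - ?G) \<le> 1 / 4"
    by (simp add: O.emeasure_eq_measure)
  then show "3/4 \<le> measure ?O ?G"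
    using O.prob_compl[OF G] by simp
qed


text \<open>Double counting of the event \<open>E\<close> that the received energy is typical and
  decoding succeeds. Its probability is at least \<open>3/4 - \<epsilon>\<close>. After retargeting,
  at a price of at most \<open>K\<close>, each pair of fading and noise samples leaves at most one
  correct choice of the messages in the triple for every choice of the others, so the probability is
  at most \<open>K\<close> divided by the number of such choices.\<close>

lemma code_size_bound:
  assumes adm: "admissible_fading \<nu> hmin hmax" and good: "good_code s \<tau> \<nu> P N M enc dec \<epsilon>"
    and rt: "conn r t" "dest t \<noteq> r" and P: "4 \<le> P" and N: "0 < N"
  shows "(3/4 - \<epsilon>) * (\<Prod>x\<in>insert t {x. dest x = r}. real (M x))
    \<le> ((3 * hmax / hmin)\<^sup>2 * P) ^ N * exp (128 * hmax\<^sup>2 * N)"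
proof -
  let ?O = "Omega M N \<nu>" and ?W = "\<Pi>\<^sub>E x\<in>UNIV. {..<M x}" and ?T = "insert t {x. dest x = r}"
  interpret A: prob_space "msg_space M" by (rule prob_space_msg)
  interpret B: prob_space "fade_space N \<nu>" by (rule prob_space_fade[OF adm])
  interpret C: prob_space "noise_space N" by (rule prob_space_noise)
  interpret BC: pair_prob_space "fade_space N \<nu>" "noise_space N" ..
  interpret O: prob_space ?O by (rule prob_space_Omega[OF adm])
  have h: "0 < hmin" "hmin \<le> hmax" using adm by (auto simp: admissible_fading_def)
  have M1: "1 \<le> M x" for x using good by (auto simp: good_code_def)
  define ok where "ok = (\<lambda>w g. (\<Sum>n<N. (cmod (noiseless s \<tau> enc w g r n))\<^sup>2) \<le> 64 * hmax\<^sup>2 * N * P)"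
  define cor where "cor = (\<lambda>w g z. \<forall>x. estimate s \<tau> N enc dec w g z x = w x)"
  let ?G = "{\<omega> \<in> space ?O. case \<omega> of (w, g, z) \<Rightarrow> ok w g}"
  let ?err = "err_event s \<tau> \<nu> N M enc dec"
  define E where "E = ?G - ?err"
  have G: "?G \<in> sets ?O" "3/4 \<le> O.prob ?G"
    using prob_received_power[OF adm good _ N, of r] P unfolding ok_def by auto
  have err: "?err \<in> sets ?O" "O.prob ?err \<le> \<epsilon>" using good by (auto simp: good_code_def)
  have E_sets: "E \<in> sets ?O" unfolding E_def using G err by auto
  have E_iff: "(w, g, z) \<in> E \<longleftrightarrow> (w, g, z) \<in> space ?O \<and> ok w g \<and> cor w g z" for w g z
    by (auto simp: E_def err_event_def cor_def)
  have "3/4 - \<epsilon> \<le> O.prob ?G - O.prob ?err" using G err by linarith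
  also have "\<dots> \<le> O.prob E"
  proof -
    have "O.prob ?G \<le> O.prob (E \<union> ?err)"
      using E_sets err G by (intro O.finite_measure_mono sets.Un) (auto simp: E_def)
    also have "\<dots> \<le> O.prob E + O.prob ?err"
      using E_sets err by (intro measure_Un_le) auto
    finally show ?thesis by simp
  qed
  finally have lower: "ennreal (3/4 - \<epsilon>) \<le> emeasure ?O E"
    by (simp add: O.emeasure_eq_measure)
  define K where "K = ((3 * hmax / hmin)\<^sup>2 * P) ^ N * exp (128 * hmax\<^sup>2 * N)"
  have K: "0 \<le> K" using P by (simp add: K_def)
  let ?others = "\<Prod>x\<in>-?T. M x"
  have E_meas: "(\<lambda>\<omega>. indicator E \<omega> :: ennreal) \<in> borel_measurable ?O"
    using E_sets by simp
  have sec: "(\<lambda>z. indicator E (w, g, z) :: ennreal) \<in> borel_measurable (noise_space N)"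
    if "w \<in> space (msg_space M)" "g \<in> space (fade_space N \<nu>)" for w g
    using that by (intro measurable_compose[OF _ E_meas[unfolded Omega_def]]) simp
  have W_space: "w \<in> space (msg_space M)" for w
    by (auto simp: msg_space_def space_PiM)
  have sec2: "(\<lambda>g. \<integral>\<^sup>+ z. indicator E (w, g, z) \<partial>noise_space N) \<in> borel_measurable (fade_space N \<nu>)" for w
  proof -
    have "(\<lambda>p. indicator E (w, p) :: ennreal) \<in> borel_measurable (fade_space N \<nu> \<Otimes>\<^sub>M noise_space N)"
      using W_space[of w] by (intro measurable_compose[OF _ E_meas[unfolded Omega_def]]) simp
    then show ?thesis using C.borel_measurable_nn_integral_fst by fastforce
  qed
  have fibre: "(\<Sum>w\<in>?W. \<integral>\<^sup>+ z. indicator E (w, g, z) \<partial>noise_space N) \<le> ennreal K * of_nat ?others"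
    if g: "g \<in> space (fade_space N \<nu>)" and gb: "\<forall>b<N. \<forall>l. hmin \<le> cmod (g b l) \<and> cmod (g b l) \<le> hmax" for g
  proof -
    define \<rho> where "\<rho> = (\<lambda>n. chan \<tau> g n (dest t) t / chan \<tau> g n r t)"
    have ch: "hmin \<le> cmod (chan \<tau> g n q x)" "cmod (chan \<tau> g n q x) \<le> hmax" if "n < N" for n q x
      using gb le_less_trans[OF div_le_dividend that] by (auto simp: chan_def)
    have \<rho>: "8 * (cmod (\<rho> n))\<^sup>2 \<le> (3 * hmax / hmin)\<^sup>2" if "n < N" for n
    proof -
      have "cmod (\<rho> n) \<le> hmax / hmin"
        unfolding \<rho>_def norm_divide using ch[OF that] h by (intro frac_le) auto
      then have "(cmod (\<rho> n))\<^sup>2 \<le> (hmax / hmin)\<^sup>2" by (intro power_mono) auto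
      moreover have "(3 * hmax / hmin)\<^sup>2 = 9 * (hmax / hmin)\<^sup>2"
        by (simp add: power_mult_distrib power_divide)
      moreover have "0 \<le> (hmax / hmin)\<^sup>2" by simp
      ultimately show ?thesis by linarith
    qed
    \<comment> \<open>The squared width \<open>sqrt P\<close> contributes the power of
      \<open>P\<close>. Since \<open>\<rho>\<close> is bounded by \<open>hmax / hmin\<close>, the
      width \<open>3 * hmax / hmin\<close> meets the requirement with \<open>9\<close> in place of
      \<open>8\<close>, and it is at least 2.\<close>
    let ?R = "\<lambda>w. retarget N r (dest t) (noiseless s \<tau> enc w g r) (sqrt P) \<rho> (3 * hmax / hmin)"
    have "(\<integral>\<^sup>+ z. indicator E (w, g, z) \<partial>noise_space N) \<le> ennreal K * (\<integral>\<^sup>+ \<zeta>. indicator E (w, g, ?R w \<zeta>) \<partial>noise_space N)" for w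
    proof (cases "ok w g")
      case False
      then have "indicator E (w, g, z) = (0 :: ennreal)" for z
        by (simp add: E_iff indicator_def)
      then show ?thesis by simp
    next
      case True
      have "(\<integral>\<^sup>+ z. indicator E (w, g, z) \<partial>noise_space N)
        \<le> ennreal (((3 * hmax / hmin)\<^sup>2 * (sqrt P)\<^sup>2) ^ N * exp (2 * (\<Sum>n<N. (cmod (noiseless s \<tau> enc w g r n))\<^sup>2) / (sqrt P)\<^sup>2))
          * (\<integral>\<^sup>+ \<zeta>. indicator E (w, g, ?R w \<zeta>) \<partial>noise_space N)"
      proof (rule nn_integral_noise_retarget[OF _ _ _ \<rho> sec[OF W_space g]])
        show "2 \<le> sqrt P" using real_sqrt_le_mono[OF P] by simp
        show "2 \<le> 3 * hmax / hmin" using h by (simp add: field_simps)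
      qed (use rt in auto)
      also have "\<dots> \<le> ennreal K * (\<integral>\<^sup>+ \<zeta>. indicator E (w, g, ?R w \<zeta>) \<partial>noise_space N)"
      proof (intro mult_right_mono ennreal_leI)
        \<comment> \<open>On the typical event the energy is at most
          \<open>64 * hmax\<^sup>2 * N * P\<close>, whence the constant 128 after dividing by
          \<open>P\<close>.\<close>
        have "2 * (\<Sum>n<N. (cmod (noiseless s \<tau> enc w g r n))\<^sup>2) / P \<le> 128 * hmax\<^sup>2 * N"
          using True P unfolding ok_def by (simp add: field_simps)
        then show "((3 * hmax / hmin)\<^sup>2 * (sqrt P)\<^sup>2) ^ N * exp (2 * (\<Sum>n<N. (cmod (noiseless s \<tau> enc w g r n))\<^sup>2) / (sqrt P)\<^sup>2) \<le> K"
          using P unfolding K_def by (intro mult_mono) auto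
      qed simp
      finally show ?thesis .
    qed
    then have "(\<Sum>w\<in>?W. \<integral>\<^sup>+ z. indicator E (w, g, z) \<partial>noise_space N)
        \<le> (\<Sum>w\<in>?W. ennreal K * (\<integral>\<^sup>+ \<zeta>. indicator E (w, g, ?R w \<zeta>) \<partial>noise_space N))"
      by (rule sum_mono)
    \<comment> \<open>One and the same \<open>\<zeta>\<close> now drives all message tuples, so sum
      and integral can be exchanged and the count of correct tuples applied pointwise in
      \<open>\<zeta>\<close>.\<close>
    also have "\<dots> = ennreal K * (\<integral>\<^sup>+ \<zeta>. (\<Sum>w\<in>?W. indicator E (w, g, ?R w \<zeta>)) \<partial>noise_space N)"
      by (subst nn_integral_sum)
        (auto simp: sum_distrib_left intro!: measurable_compose[OF measurable_retarget sec[OF W_space g]])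
    also have "\<dots> \<le> ennreal K * (\<integral>\<^sup>+ \<zeta>. of_nat ?others \<partial>noise_space N)"
    proof (intro mult_left_mono nn_integral_mono)
      fix \<zeta>
      have "(\<Sum>w\<in>?W. indicator E (w, g, ?R w \<zeta>) :: ennreal)
          \<le> (\<Sum>w\<in>?W. indicator {w \<in> ?W. cor w g (?R w \<zeta>)} w)"
        by (intro sum_mono) (auto simp: indicator_def E_iff)
      also have "\<dots> = of_nat (card {w \<in> ?W. cor w g (?R w \<zeta>)})"
      proof -
        have fin: "finite ?W" by (intro finite_PiE) auto
        have "(\<Sum>w\<in>?W. indicator {w \<in> ?W. cor w g (?R w \<zeta>)} w :: ennreal)
            = (\<Sum>w\<in>?W. if w \<in> {w \<in> ?W. cor w g (?R w \<zeta>)} then 1 else 0)"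
          by (intro sum.cong) (auto simp: indicator_def)
        also have "\<dots> = (\<Sum>w\<in>?W \<inter> {w \<in> ?W. cor w g (?R w \<zeta>)}. 1)"
          by (rule sum.inter_restrict[symmetric, OF fin])
        also have "?W \<inter> {w \<in> ?W. cor w g (?R w \<zeta>)} = {w \<in> ?W. cor w g (?R w \<zeta>)}" by auto
        finally show ?thesis by simp
      qed
      also have "\<dots> \<le> of_nat ?others"
        unfolding cor_def \<rho>_def of_nat_le_iff
      proof (rule card_jointly_decodable[OF rt])
        show "chan \<tau> g n r t \<noteq> 0" if "n < N" for n
          using ch(1)[OF that, of r t] h by auto
      qed
      finally show "(\<Sum>w\<in>?W. indicator E (w, g, ?R w \<zeta>)) \<le> (of_nat ?others :: ennreal)" .
    qed simp
    finally show ?thesis by (simp add: C.emeasure_space_1)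
  qed
  have "emeasure ?O E = (\<integral>\<^sup>+ \<omega>. indicator E \<omega> \<partial>?O)" using E_sets by simp
  also have "\<dots> = (\<integral>\<^sup>+ w. \<integral>\<^sup>+ g. \<integral>\<^sup>+ z. indicator E (w, g, z) \<partial>noise_space N \<partial>fade_space N \<nu> \<partial>msg_space M)"
    unfolding Omega_def
    by (subst BC.nn_integral_fst[symmetric], use E_meas in \<open>simp add: Omega_def\<close>)
      (auto intro!: nn_integral_cong C.nn_integral_fst[symmetric]
        measurable_compose[OF _ E_meas[unfolded Omega_def]] simp: W_space)
  also have "\<dots> = ennreal (1 / (\<Prod>x\<in>UNIV. real (M x)))
      * (\<Sum>w\<in>?W. \<integral>\<^sup>+ g. \<integral>\<^sup>+ z. indicator E (w, g, z) \<partial>noise_space N \<partial>fade_space N \<nu>)"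
  proof (rule nn_integral_msg_space[OF M1])
    have "(\<lambda>p. \<integral>\<^sup>+ z. indicator E (fst p, snd p, z) \<partial>noise_space N) \<in> borel_measurable (msg_space M \<Otimes>\<^sub>M fade_space N \<nu>)"
    proof -
      have "(\<lambda>q. indicator E (fst (fst q), snd (fst q), snd q) :: ennreal)
          \<in> borel_measurable ((msg_space M \<Otimes>\<^sub>M fade_space N \<nu>) \<Otimes>\<^sub>M noise_space N)"
        by (rule measurable_compose[OF _ E_meas[unfolded Omega_def]]) measurable
      from C.borel_measurable_nn_integral_fst[OF this] show ?thesis by simp
    qed
    from B.borel_measurable_nn_integral_fst[OF this]
    show "(\<lambda>w. \<integral>\<^sup>+ g. \<integral>\<^sup>+ z. indicator E (w, g, z) \<partial>noise_space N \<partial>fade_space N \<nu>) \<in> borel_measurable (msg_space M)"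
      by simp
  qed
  also have "(\<Sum>w\<in>?W. \<integral>\<^sup>+ g. \<integral>\<^sup>+ z. indicator E (w, g, z) \<partial>noise_space N \<partial>fade_space N \<nu>)
      = (\<integral>\<^sup>+ g. (\<Sum>w\<in>?W. \<integral>\<^sup>+ z. indicator E (w, g, z) \<partial>noise_space N) \<partial>fade_space N \<nu>)"
    by (rule nn_integral_sum[symmetric]) (rule sec2)
  also have "\<dots> \<le> (\<integral>\<^sup>+ g. ennreal K * of_nat ?others \<partial>fade_space N \<nu>)"
    using AE_fade_bounds[OF adm, of N] AE_space
    by (intro nn_integral_mono_AE, eventually_elim) (rule fibre)
  also have "\<dots> = ennreal (K * ?others)"
    using K by (simp add: B.emeasure_space_1 ennreal_mult' ennreal_of_nat_eq_real_of_nat)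
  finally have "emeasure ?O E \<le> ennreal (1 / (\<Prod>x\<in>UNIV. real (M x))) * ennreal (K * ?others)"
    by (simp add: mult_left_mono)
  also have "\<dots> = ennreal (1 / (\<Prod>x\<in>UNIV. real (M x)) * (K * ?others))"
    by (rule ennreal_mult'[symmetric]) (simp add: prod_nonneg)
  finally have "ennreal (3/4 - \<epsilon>) \<le> ennreal (1 / (\<Prod>x\<in>UNIV. real (M x)) * (K * ?others))"
    using lower by (rule order_trans[rotated])
  then have "3/4 - \<epsilon> \<le> 1 / (\<Prod>x\<in>UNIV. real (M x)) * (K * ?others)"
    using K by (subst (asm) ennreal_le_iff) (auto intro!: mult_nonneg_nonneg divide_nonneg_nonneg prod_nonneg)
  moreover have "(\<Prod>x\<in>UNIV. real (M x)) = (\<Prod>x\<in>?T. real (M x)) * ?others"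
    by (subst prod.subset_diff[of ?T UNIV]) (auto simp: Compl_eq_Diff_UNIV)
  moreover have "0 < real ?others" "0 < (\<Prod>x\<in>?T. real (M x))"
    using M1 by (auto intro!: prod_pos simp: less_eq_Suc_le)
  moreover have "e * a \<le> K" if "e \<le> 1 / c * (K * b)" "c = a * b" "0 < b" "0 < a" for a b c e :: real
    using that by (simp add: field_simps)
  ultimately show ?thesis unfolding K_def[symmetric] by blast
qed

section \<open>From code sizes to rates\<close>

lemma rate_triple_bound:
  assumes adm: "admissible_fading \<nu> hmin hmax" and ach: "achievable s \<tau> \<nu> P R"
    and rt: "conn r t" "dest t \<noteq> r" and P: "4 \<le> P"
  shows "(\<Sum>x\<in>insert t {x. dest x = r}. R x)
    \<le> log 2 P + (log 2 ((3 * hmax / hmin)\<^sup>2 * exp (128 * hmax\<^sup>2)) + 2)"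
proof -
  let ?T = "insert t {x. dest x = r}"
  define K where "K = (3 * hmax / hmin)\<^sup>2 * exp (128 * hmax\<^sup>2)"
  have "0 < hmin" "0 < hmax" using adm by (auto simp: admissible_fading_def)
  then have K: "0 < K" by (simp add: K_def)
  \<comment> \<open>A single code with \<open>\<epsilon> = 1/8\<close> suffices:
    \<open>3/4 - 1/8\<close> exceeds 1/2, which costs one bit in all and so at most 1 per use, and
    the rate slack of 1/8 per user adds up to at most 1. This is the additive 2 of the
    bound.\<close>
  obtain N M enc dec where N: "0 < N" and good: "good_code s \<tau> \<nu> P N M enc dec (1/8)"
    and R: "\<And>x. R x - 1/8 \<le> log 2 (real (M x)) / real N"
    using ach unfolding achievable_def by (metis zero_less_divide_1_iff zero_less_numeral)
  have M: "1 \<le> M x" for x using good by (auto simp: good_code_def)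
  let ?L = "\<Sum>x\<in>?T. log 2 (real (M x))"
  have pos: "0 < (\<Prod>x\<in>?T. real (M x))" using M by (auto intro!: prod_pos simp: less_eq_Suc_le)
  have "1/2 * (\<Prod>x\<in>?T. real (M x)) \<le> (3/4 - 1/8) * (\<Prod>x\<in>?T. real (M x))"
    using pos by (intro mult_right_mono) auto
  also have "\<dots> \<le> (K * P) ^ N"
    using code_size_bound[OF adm good rt P N]
    by (simp add: K_def power_mult_distrib exp_of_nat_mult[symmetric] ac_simps)
  finally have "log 2 (\<Prod>x\<in>?T. real (M x)) \<le> log 2 (2 * (K * P) ^ N)"
    using pos by (intro log_mono) auto
  also have "log 2 (\<Prod>x\<in>?T. real (M x)) = ?L"
  proof -
    have "ln (\<Prod>x\<in>?T. real (M x)) = (\<Sum>x\<in>?T. ln (real (M x)))"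
      using M by (intro ln_prod) (auto simp: Suc_le_eq)
    then show ?thesis by (simp add: log_def sum_divide_distrib)
  qed
  also have "log 2 (2 * (K * P) ^ N) = 1 + N * (log 2 K + log 2 P)"
    using K P by (simp add: log_mult log_nat_power)
  finally have "?L / N \<le> 1 / N + (log 2 K + log 2 P)"
    using N by (simp add: field_simps)
  moreover have "1 / real N \<le> 1" using N by simp
  moreover have "(\<Sum>x\<in>?T. R x - 1/8) \<le> ?L / N"
    unfolding sum_divide_distrib by (rule sum_mono) (rule R)
  moreover have "(\<Sum>x\<in>?T. R x) - 1 \<le> (\<Sum>x\<in>?T. R x - 1/8)"
  proof -
    have "card ?T \<le> card (UNIV :: tx set)" by (rule card_mono) auto
    also have "\<dots> = 8" by (simp add: UNIV_tx)
    finally show ?thesis by (simp add: sum_subtractf)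
  qed
  ultimately show ?thesis unfolding K_def[symmetric] by linarith
qed

text \<open>Every receiver hears exactly two interferers and every user interferes at exactly one
  receiver. So a user enters the two triples of its own cell and one more as an interferer, and
  adding all triples bounds three times the sum rate.\<close>

lemma sum_rate_bound:
  assumes adm: "admissible_fading \<nu> hmin hmax" and ach: "achievable s \<tau> \<nu> P R" and P: "4 \<le> P"
  shows "(\<Sum>x\<in>UNIV. R x)
    \<le> 8/3 * (log 2 P + (log 2 ((3 * hmax / hmin)\<^sup>2 * exp (128 * hmax\<^sup>2)) + 2))"
proof -
  define B where "B = log 2 P + (log 2 ((3 * hmax / hmin)\<^sup>2 * exp (128 * hmax\<^sup>2)) + 2)"
  note B = rate_triple_bound[OF adm ach _ _ P, folded B_def]
  have D: "{x. dest x = RA} = {a1, a2}" "{x. dest x = RB} = {b1, b2}"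
    "{x. dest x = RC} = {c1, c2}" "{x. dest x = RD} = {d1, d2}"
    using dest.elims by (auto; blast)+
  have "R b1 + R a1 + R a2 \<le> B" using B[of RA b1] by (simp add: conn_def D)
  moreover have "R c2 + R a1 + R a2 \<le> B" using B[of RA c2] by (simp add: conn_def D)
  moreover have "R a1 + R b1 + R b2 \<le> B" using B[of RB a1] by (simp add: conn_def D)
  moreover have "R d2 + R b1 + R b2 \<le> B" using B[of RB d2] by (simp add: conn_def D)
  moreover have "R a2 + R c1 + R c2 \<le> B" using B[of RC a2] by (simp add: conn_def D)
  moreover have "R d1 + R c1 + R c2 \<le> B" using B[of RC d1] by (simp add: conn_def D)
  moreover have "R c1 + R d1 + R d2 \<le> B" using B[of RD c1] by (simp add: conn_def D)
  moreover have "R b2 + R d1 + R d2 \<le> B" using B[of RD b2] by (simp add: conn_def D)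
  moreover have "(\<Sum>x\<in>UNIV. R x) = R a1 + R a2 + R b1 + R b2 + R c1 + R c2 + R d1 + R d2"
    by (simp add: UNIV_tx)
  ultimately show ?thesis unfolding B_def[symmetric] by linarith
qed

subsection \<open>Achievability\<close>

text \<open>A word of the ball is determined by the set of positions where it differs from the
  centre, with at most \<open>2 ^ n\<close> possibilities, and by its at most \<open>D\<close>
  symbols there.\<close>

lemma card_hamming_ball:
  assumes "finite A" "card A = q" "1 \<le> q" "x \<in> (\<Pi>\<^sub>E j\<in>{..<n}. A)"
  shows "card {y \<in> (\<Pi>\<^sub>E j\<in>{..<n::nat}. A). card {j. j < n \<and> x j \<noteq> y j} \<le> D} \<le> 2 ^ n * q ^ D"
    (is "card ?B \<le> _")
proof -
  let ?F = "{S \<in> Pow {..<n}. card S \<le> D}"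
  let ?I = "\<lambda>S. (\<lambda>v. \<lambda>j\<in>{..<n}. if j \<in> S then v j else x j) ` (\<Pi>\<^sub>E j\<in>S. A)"
  have sub: "?B \<subseteq> (\<Union>S\<in>?F. ?I S)"
  proof
    fix y assume y: "y \<in> ?B"
    let ?S = "{j. j < n \<and> x j \<noteq> y j}"
    have "y = (\<lambda>j\<in>{..<n}. if j \<in> ?S then restrict y ?S j else x j)"
      using y by (auto simp: fun_eq_iff PiE_iff extensional_def)
    moreover have "restrict y ?S \<in> (\<Pi>\<^sub>E j\<in>?S. A)" using y by (auto simp: PiE_iff)
    moreover have "?S \<in> ?F" using y by auto
    ultimately show "y \<in> (\<Union>S\<in>?F. ?I S)" by blast
  qed
  have fin: "finite S" if "S \<in> ?F" for S using that by (auto intro: finite_subset)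
  have "finite (\<Union>S\<in>?F. ?I S)"
  proof (rule finite_UN_I)
    show "finite (?I S)" if "S \<in> ?F" for S
      using fin[OF that] assms by (intro finite_imageI finite_PiE) auto
  qed auto
  then have "card ?B \<le> card (\<Union>S\<in>?F. ?I S)" using sub by (rule card_mono)
  also have "\<dots> \<le> (\<Sum>S\<in>?F. card (?I S))" by (rule card_UN_le) auto
  also have "\<dots> \<le> (\<Sum>S\<in>?F. q ^ D)"
  proof (rule sum_mono)
    fix S assume S: "S \<in> ?F"
    have "card (?I S) \<le> card (\<Pi>\<^sub>E j\<in>S. A)"
      using fin[OF S] assms by (intro card_image_le finite_PiE) auto
    also have "\<dots> = q ^ card S" using fin[OF S] assms by (simp add: card_PiE)
    also have "\<dots> \<le> q ^ D" using S assms by (intro power_increasing) auto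
    finally show "card (?I S) \<le> q ^ D" .
  qed
  also have "\<dots> = card ?F * q ^ D" by simp
  also have "\<dots> \<le> 2 ^ n * q ^ D"
  proof -
    have "card ?F \<le> card (Pow {..<n})" by (rule card_mono) auto
    then show ?thesis by (simp add: card_Pow)
  qed
  finally show ?thesis .
qed

text \<open>A code of greatest cardinality cannot be extended, so the balls of radius
  \<open>D\<close> around its words cover all words. The loss \<open>2 ^ n\<close> is one bit per
  symbol whatever the alphabet, hence negligible for large constellations.\<close>

lemma gilbert_varshamov:
  assumes A: "finite A" "card A = q" "1 \<le> q"
  obtains C where "C \<subseteq> (\<Pi>\<^sub>E j\<in>{..<n::nat}. A)"
    and "\<And>x y. x \<in> C \<Longrightarrow> y \<in> C \<Longrightarrow> x \<noteq> y \<Longrightarrow> D < card {j. j < n \<and> x j \<noteq> y j}"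
    and "q ^ n \<le> card C * (2 ^ n * q ^ D)"
proof -
  let ?W = "\<Pi>\<^sub>E j\<in>{..<n}. A"
  define code where "code C \<longleftrightarrow> C \<subseteq> ?W \<and> (\<forall>x\<in>C. \<forall>y\<in>C. x \<noteq> y \<longrightarrow> D < card {j. j < n \<and> x j \<noteq> y j})" for C
  have W: "finite ?W" using A by (intro finite_PiE) auto
  have "code {}" by (simp add: code_def)
  moreover have "\<forall>C. code C \<longrightarrow> card C < Suc (card ?W)"
    using W by (auto simp: code_def less_Suc_eq_le intro: card_mono)
  ultimately have "\<exists>C. code C \<and> (\<forall>C'. code C' \<longrightarrow> card C' \<le> card C)"
    by (rule ex_has_greatest_nat)
  then obtain C where code: "code C" and max: "\<And>C'. code C' \<Longrightarrow> card C' \<le> card C" by blast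
  note C = code[unfolded code_def]
  have finC: "finite C" using C W by (auto intro: finite_subset)
  have "?W \<subseteq> (\<Union>x\<in>C. {y \<in> ?W. card {j. j < n \<and> x j \<noteq> y j} \<le> D})"
  proof
    fix y assume y: "y \<in> ?W"
    show "y \<in> (\<Union>x\<in>C. {y \<in> ?W. card {j. j < n \<and> x j \<noteq> y j} \<le> D})"
    proof (rule ccontr)
      assume *: "\<not> ?thesis"
      then have far: "D < card {j. j < n \<and> x j \<noteq> y j}" if "x \<in> C" for x
        using that y by (auto simp: not_le)
      have "y \<notin> C" using far[of y] by auto
      moreover have "code (insert y C)"
        unfolding code_def
      proof (intro conjI ballI impI)
        show "insert y C \<subseteq> ?W" using C y by simp
        have far': "D < card {j. j < n \<and> y j \<noteq> x j}" if "x \<in> C" for x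
          using far[OF that] by (simp add: eq_commute)
        show "D < card {j. j < n \<and> u j \<noteq> v j}" if "u \<in> insert y C" "v \<in> insert y C" "u \<noteq> v" for u v
          using that C far far' by auto
      qed
      ultimately show False using max[of "insert y C"] finC by simp
    qed
  qed
  then have "card ?W \<le> card (\<Union>x\<in>C. {y \<in> ?W. card {j. j < n \<and> x j \<noteq> y j} \<le> D})"
    using W finC by (intro card_mono) auto
  also have "\<dots> \<le> (\<Sum>x\<in>C. card {y \<in> ?W. card {j. j < n \<and> x j \<noteq> y j} \<le> D})"
    by (rule card_UN_le[OF finC])
  also have "\<dots> \<le> (\<Sum>x\<in>C. 2 ^ n * q ^ D)"
    using C by (intro sum_mono card_hamming_ball[OF A]) auto
  finally have size: "q ^ n \<le> card C * (2 ^ n * q ^ D)" using A by (simp add: card_PiE)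
  show ?thesis by (rule that[OF _ _ size]) (use C in simp_all)
qed

lemma qam_constellation:
  assumes d: "0 < d"
  obtains A :: "complex set" where "finite A" "card A = L\<^sup>2"
    "\<And>x. x \<in> A \<Longrightarrow> (cmod x)\<^sup>2 \<le> 2 * (real L)\<^sup>2 * d\<^sup>2"
    "\<And>x y. x \<in> A \<Longrightarrow> y \<in> A \<Longrightarrow> x \<noteq> y \<Longrightarrow> d \<le> cmod (x - y)"
proof
  let ?f = "\<lambda>(i, j). Complex (d * real i) (d * real j)"
  let ?A = "?f ` ({..<L} \<times> {..<L})"
  show "finite ?A" by simp
  have "inj_on ?f ({..<L} \<times> {..<L})" using d by (auto simp: inj_on_def)
  then show "card ?A = L\<^sup>2" by (simp add: card_image power2_eq_square)
  show "(cmod x)\<^sup>2 \<le> 2 * (real L)\<^sup>2 * d\<^sup>2" if xA: "x \<in> ?A" for x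
  proof -
    obtain i j where x: "x = Complex (d * real i) (d * real j)" "i < L" "j < L" using xA by auto
    then have "(cmod x)\<^sup>2 = d\<^sup>2 * ((real i)\<^sup>2 + (real j)\<^sup>2)"
      by (simp add: cmod_power2 power_mult_distrib distrib_left)
    also have "\<dots> \<le> d\<^sup>2 * ((real L)\<^sup>2 + (real L)\<^sup>2)"
      using x by (intro mult_left_mono add_mono power_mono) auto
    finally show ?thesis by (simp add: mult.commute)
  qed
  have sep: "d \<le> \<bar>d * real i - d * real i'\<bar>" if "i \<noteq> i'" for i i'
  proof -
    have "1 \<le> \<bar>real i - real i'\<bar>" using that by linarith
    then have "d * 1 \<le> d * \<bar>real i - real i'\<bar>" using d by (intro mult_left_mono) auto
    also have "\<dots> = \<bar>d * real i - d * real i'\<bar>" using d by (simp add: abs_mult right_diff_distrib[symmetric])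
    finally show ?thesis by simp
  qed
  show "d \<le> cmod (x - y)" if xy: "x \<in> ?A" "y \<in> ?A" "x \<noteq> y" for x y
  proof -
    obtain i j i' j' where "x = Complex (d * real i) (d * real j)" "y = Complex (d * real i') (d * real j')"
      using xy by auto
    moreover from this have "i \<noteq> i' \<or> j \<noteq> j'" using xy by auto
    ultimately show ?thesis
      using sep[of i i'] sep[of j j'] abs_Re_le_cmod[of "x - y"] abs_Im_le_cmod[of "x - y"] by auto
  qed
qed

section \<open>Rare large noise samples\<close>

text \<open>Exponential Markov inequality. The affine bound with \<open>F = 1\<close>,
  \<open>a = 2\<close> and \<open>b = 0\<close> doubles as a bound by 4 on the expectation of
  \<open>exp (|z|^2 / 4)\<close>.\<close>

lemma cgauss_tail: "emeasure cgauss {z. T < cmod z} \<le> ennreal (4 * exp (- T\<^sup>2 / 4))" if "0 \<le> T"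
proof -
  interpret prob_space cgauss by (rule prob_space_cgauss)
  have "emeasure cgauss {z. T < cmod z} = (\<integral>\<^sup>+ z. indicator {z. T < cmod z} z \<partial>cgauss)"
    by (rule nn_integral_indicator[symmetric]) simp
  also have "\<dots> \<le> (\<integral>\<^sup>+ z. ennreal (exp (- T\<^sup>2 / 4)) * ennreal (exp ((cmod z)\<^sup>2 / 4)) \<partial>cgauss)"
  proof (rule nn_integral_mono)
    fix z
    show "indicator {z. T < cmod z} z \<le> ennreal (exp (- T\<^sup>2 / 4)) * ennreal (exp ((cmod z)\<^sup>2 / 4))"
    proof (cases "T < cmod z")
      case True
      then have "T\<^sup>2 \<le> (cmod z)\<^sup>2" using that by (intro power_mono) auto
      then have "1 \<le> exp (- T\<^sup>2 / 4) * exp ((cmod z)\<^sup>2 / 4)" by (simp flip: exp_add)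
      then show ?thesis using True
        by (simp add: ennreal_ge_1 flip: ennreal_mult')
    qed simp
  qed
  also have "\<dots> = ennreal (exp (- T\<^sup>2 / 4)) * (\<integral>\<^sup>+ z. 1 * ennreal (exp ((cmod z)\<^sup>2 / 4)) \<partial>cgauss)"
    by (subst nn_integral_cmult) (auto simp: measurable_cong_sets[OF sets_cgauss refl])
  also have "\<dots> \<le> ennreal (exp (- T\<^sup>2 / 4)) * (ennreal (2\<^sup>2 * exp (2 * (cmod 0)\<^sup>2 / 2\<^sup>2)) * (\<integral>\<^sup>+ z. 1 \<partial>cgauss))"
    by (intro mult_left_mono cgauss_affine_bound[where F = "\<lambda>_. 1"]) auto
  also have "\<dots> = ennreal (4 * exp (- T\<^sup>2 / 4))"
    using emeasure_space_1 by (simp add: ennreal_mult'' mult.commute)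
  finally show ?thesis .
qed

text \<open>Some \<open>k + 1\<close> of the \<open>4 * N\<close> independent samples must all be
  large; the union bound runs over at most \<open>2 ^ (4 * N)\<close> index sets. The cover
  \<open>U\<close> is a finite union of boxes, which makes it measurable at once.\<close>

lemma emeasure_many_large_noise:
  assumes T: "0 \<le> T"
  obtains U where "U \<in> sets (noise_space N)"
    and "{z \<in> space (noise_space N). k < card {i \<in> {..<N} \<times> UNIV. T < cmod (z i)}} \<subseteq> U"
    and "emeasure (noise_space N) U \<le> ennreal (2 ^ (4 * N) * (4 * exp (- T\<^sup>2 / 4)) ^ (k + 1))"
proof
  interpret product_sigma_finite "\<lambda>_ :: nat \<times> rx. cgauss" by (rule product_sigma_finite_cgauss)
  interpret C: prob_space cgauss by (rule prob_space_cgauss)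
  let ?I = "{..<N} \<times> (UNIV :: rx set)" and ?p = "4 * exp (- T\<^sup>2 / 4)"
  let ?F = "{S \<in> Pow ?I. card S = k + 1}"
  let ?B = "\<lambda>S. \<Pi>\<^sub>E i\<in>?I. if i \<in> S then {z. T < cmod z} else UNIV"
  let ?U = "\<Union>S\<in>?F. ?B S"
  have I: "finite ?I" by simp
  have B: "?B S \<in> sets (noise_space N)" for S
    unfolding noise_space_def by (rule sets_PiM_I_finite) auto
  have F: "finite ?F" by simp
  show "?U \<in> sets (noise_space N)" using B F by (intro sets.finite_UN) auto
  show "{z \<in> space (noise_space N). k < card {i \<in> ?I. T < cmod (z i)}} \<subseteq> ?U"
  proof
    fix z assume z: "z \<in> {z \<in> space (noise_space N). k < card {i \<in> ?I. T < cmod (z i)}}"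
    then have "k + 1 \<le> card {i \<in> ?I. T < cmod (z i)}" by simp
    then obtain S where "S \<subseteq> {i \<in> ?I. T < cmod (z i)}" "card S = k + 1"
      by (rule obtain_subset_with_card_n)
    moreover have "z \<in> extensional ?I" using z by (auto simp: noise_space_def space_PiM PiE_def)
    ultimately have "S \<in> ?F" "z \<in> ?B S" by (auto simp: PiE_iff)
    then show "z \<in> ?U" by blast
  qed
  have "emeasure (noise_space N) ?U \<le> (\<Sum>S\<in>?F. emeasure (noise_space N) (?B S))"
    using B F by (intro emeasure_subadditive_finite) auto
  also have "\<dots> \<le> (\<Sum>S\<in>?F. ennreal (?p ^ (k + 1)))"
  proof (rule sum_mono)
    fix S assume S: "S \<in> ?F"
    have "emeasure (noise_space N) (?B S) = (\<Prod>i\<in>?I. emeasure cgauss (if i \<in> S then {z. T < cmod z} else UNIV))"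
      unfolding noise_space_def by (rule emeasure_PiM) auto
    also have "\<dots> = (\<Prod>i\<in>?I. if i \<in> S then emeasure cgauss {z. T < cmod z} else 1)"
      using C.emeasure_space_1 by (intro prod.cong) auto
    also have "\<dots> = (\<Prod>i\<in>S. emeasure cgauss {z. T < cmod z})"
      using S by (subst prod.inter_restrict[OF I, symmetric]) (auto intro!: prod.cong simp: Int_absorb1)
    also have "\<dots> \<le> (\<Prod>i\<in>S. ennreal ?p)"
      by (rule prod_mono_ennreal) (rule cgauss_tail[OF T])
    also have "\<dots> = ennreal ?p ^ (k + 1)" using S by simp
    also have "\<dots> = ennreal (?p ^ (k + 1))" by (rule ennreal_power) simp
    finally show "emeasure (noise_space N) (?B S) \<le> ennreal (?p ^ (k + 1))" .
  qed
  also have "\<dots> = ennreal (card ?F * ?p ^ (k + 1))"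
    unfolding sum_constant ennreal_of_nat_eq_real_of_nat by (rule ennreal_mult'[symmetric]) simp
  also have "\<dots> \<le> ennreal (2 ^ (4 * N) * ?p ^ (k + 1))"
  proof (intro ennreal_leI mult_right_mono)
    have "card ?F \<le> card (Pow ?I)" using I by (intro card_mono) auto
    also have "\<dots> = 2 ^ (4 * N)" using I by (simp add: card_Pow card_cartesian_product UNIV_rx mult.commute)
    finally have "real (card ?F) \<le> real (2 ^ (4 * N))" by (rule of_nat_mono)
    then show "real (card ?F) \<le> 2 ^ (4 * N)" by simp
  qed simp
  finally show "emeasure (noise_space N) ?U \<le> ennreal (2 ^ (4 * N) * ?p ^ (k + 1))" .
qed

lemma AE_msg_space:
  assumes M: "\<And>t. 1 \<le> M t"
  shows "AE w in msg_space M. \<forall>t. w t < M t"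
proof -
  have "AE w in msg_space M. \<forall>t\<in>UNIV. w t < M t"
  proof (rule AE_finite_allI)
    fix t
    have ne: "{..<M t} \<noteq> {}" using M[of t] by (auto simp: lessThan_empty_iff)
    show "AE w in msg_space M. w t < M t"
      unfolding msg_space_def
      by (rule AE_PiM_component[where P = "\<lambda>m. m < M t"])
        (use ne in \<open>auto simp: prob_space_measure_pmf AE_measure_pmf_iff\<close>)
  qed simp
  then show ?thesis by simp
qed

lemma AE_Omega_msg:
  assumes adm: "admissible_fading \<nu> hmin hmax" and M: "\<And>t. 1 \<le> M t"
  shows "AE \<omega> in Omega M N \<nu>. case \<omega> of (w, g, z) \<Rightarrow> \<forall>t. w t < M t"
proof -
  interpret B: prob_space "fade_space N \<nu>" by (rule prob_space_fade[OF adm])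
  interpret C: prob_space "noise_space N" by (rule prob_space_noise)
  interpret BC: pair_prob_space "fade_space N \<nu>" "noise_space N" ..
  have "AE \<omega> in Omega M N \<nu>. \<forall>t. fst \<omega> t < M t"
    unfolding Omega_def
    by (rule AE_pair_fst[OF BC.sigma_finite_measure_axioms AE_msg_space[OF M]])
  then show ?thesis by (simp add: case_prod_beta')
qed

lemma emeasure_Omega_noise:
  assumes adm: "admissible_fading \<nu> hmin hmax" and U: "U \<in> sets (noise_space N)"
  shows "{\<omega> \<in> space (Omega M N \<nu>). snd (snd \<omega>) \<in> U} \<in> sets (Omega M N \<nu>)"
    and "emeasure (Omega M N \<nu>) {\<omega> \<in> space (Omega M N \<nu>). snd (snd \<omega>) \<in> U} = emeasure (noise_space N) U"
proof -
  interpret A: prob_space "msg_space M" by (rule prob_space_msg)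
  interpret B: prob_space "fade_space N \<nu>" by (rule prob_space_fade[OF adm])
  interpret C: prob_space "noise_space N" by (rule prob_space_noise)
  interpret BC: pair_prob_space "fade_space N \<nu>" "noise_space N" ..
  have eq: "{\<omega> \<in> space (Omega M N \<nu>). snd (snd \<omega>) \<in> U}
      = space (msg_space M) \<times> (space (fade_space N \<nu>) \<times> U)"
    using sets.sets_into_space[OF U] by (auto simp: Omega_def space_pair_measure)
  have inner: "space (fade_space N \<nu>) \<times> U \<in> sets (fade_space N \<nu> \<Otimes>\<^sub>M noise_space N)"
    using U by auto
  show "{\<omega> \<in> space (Omega M N \<nu>). snd (snd \<omega>) \<in> U} \<in> sets (Omega M N \<nu>)"
    unfolding eq unfolding Omega_def using inner U by (intro pair_measureI) auto
  show "emeasure (Omega M N \<nu>) {\<omega> \<in> space (Omega M N \<nu>). snd (snd \<omega>) \<in> U} = emeasure (noise_space N) U"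
    unfolding eq unfolding Omega_def
    using U inner
    by (subst BC.emeasure_pair_measure_Times)
      (auto simp: C.emeasure_pair_measure_Times A.emeasure_space_1 B.emeasure_space_1)
qed

text \<open>Over a block of three uses every transmitter repeats one symbol along a fixed direction. Any three
  of the four directions are linearly independent, and at each receiver both interferers share theirs.\<close>
fun direction :: "tx \<Rightarrow> nat \<Rightarrow> complex" where
  "direction a1 i = (if i = 1 then 1 else 0)"
| "direction a2 i = (if i = 2 then 1 else 0)"
| "direction b1 i = (if i = 0 then 1 else 0)"
| "direction b2 i = 1"
| "direction c1 i = 1"
| "direction c2 i = (if i = 0 then 1 else 0)"
| "direction d1 i = (if i = 2 then 1 else 0)"
| "direction d2 i = (if i = 1 then 1 else 0)"

text \<open>Each functional kills the common direction of the two interferers and that of the other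
  user in the cell, and takes the value 1 on its own direction. The differences cancel the constant
  direction because the channel does not change within the block. The entries are 0, 1 and -1 with
  at most two of them nonzero, so noise grows at most by a factor 2 and the remaining gain is the
  plain channel coefficient.\<close>

fun zero_force :: "tx \<Rightarrow> (nat \<Rightarrow> complex) \<Rightarrow> nat \<Rightarrow> complex" where
  "zero_force a1 y j = y (3 * j + 1)"
| "zero_force a2 y j = y (3 * j + 2)"
| "zero_force b1 y j = y (3 * j) - y (3 * j + 2)"
| "zero_force b2 y j = y (3 * j + 2)"
| "zero_force c1 y j = y (3 * j + 1)"
| "zero_force c2 y j = y (3 * j) - y (3 * j + 1)"
| "zero_force d1 y j = y (3 * j + 2) - y (3 * j)"
| "zero_force d2 y j = y (3 * j + 1) - y (3 * j)"

section \<open>Block coding with bounded distance decoding\<close>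

definition block_enc :: "(nat \<Rightarrow> nat \<Rightarrow> complex) \<Rightarrow> encoder" where
  "block_enc cw t m g n = direction t (n mod 3) * cw m (n div 3)"

text \<open>The threshold \<open>2 * T\<close> bounds the noise after zero-forcing whenever none of
  the three samples involved exceeds \<open>T\<close>.\<close>

definition mismatches :: "nat \<Rightarrow> real \<Rightarrow> (nat \<Rightarrow> nat \<Rightarrow> complex) \<Rightarrow> tx \<Rightarrow> (nat \<Rightarrow> complex)
    \<Rightarrow> (nat \<Rightarrow> tx \<Rightarrow> complex) \<Rightarrow> nat \<Rightarrow> nat set" where
  "mismatches n T cw t y h m = {j. j < n \<and> 2 * T < cmod (zero_force t y j - h (3 * j) t * cw m j)}"

definition block_dec :: "nat \<Rightarrow> nat \<Rightarrow> nat \<Rightarrow> real \<Rightarrow> (nat \<Rightarrow> nat \<Rightarrow> complex) \<Rightarrow> decoder" where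
  "block_dec n m0 k T cw r y h t = (LEAST m. m < m0 \<and> card (mismatches n T cw t y h m) \<le> k)"

lemma cmod_direction_le: "cmod (direction t i) \<le> 1"
  by (cases t) auto

lemma zero_force_rx_sig:
  "zero_force t (rx_sig s 3 (block_enc cw) w g z (dest t)) j
    = g j (dest t, t) * cw (w t) j + zero_force t (\<lambda>n. z (n, dest t)) j"
proof -
  have "(3 * j) div 3 = j" "(3 * j + 1) div 3 = j" "(3 * j + 2) div 3 = j"
    "(3 * j) mod 3 = 0" "(3 * j + 1) mod 3 = 1" "(3 * j + 2) mod 3 = 2" by presburger+
  then show ?thesis
    by (cases t) (simp_all add: rx_sig_eq noiseless_def tx_sig_def block_enc_def chan_def algebra_simps)
qed

lemma cmod_zero_force_le:
  assumes "\<And>i. i < 3 \<Longrightarrow> cmod (y (3 * j + i)) \<le> T" and T: "0 \<le> T"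
  shows "cmod (zero_force t y j) \<le> 2 * T"
proof -
  have "cmod (y (3 * j)) \<le> T" "cmod (y (3 * j + 1)) \<le> T" "cmod (y (3 * j + 2)) \<le> T"
    using assms(1)[of 0] assms(1)[of 1] assms(1)[of 2] by auto
  then show ?thesis
    using T by (cases t) (auto intro: norm_triangle_le_diff)
qed

lemma measurable_zero_force:
  assumes "\<And>i. (\<lambda>\<omega>. y \<omega> i) \<in> borel_measurable S"
  shows "(\<lambda>\<omega>. zero_force t (y \<omega>) j) \<in> borel_measurable S"
  using assms by (cases t) auto

lemma zero_force_cong:
  assumes "\<And>i. i < 3 \<Longrightarrow> y (3 * j + i) = y' (3 * j + i)"
  shows "zero_force t y j = zero_force t y' j"
  using assms[of 0] assms[of 1] assms[of 2] by (cases t) auto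

text \<open>Call a position clean if none of its noise samples is large. There the true codeword
  shows no mismatch, whereas a word with a different symbol deviates by at least
  \<open>hmin * d - 2 * T\<close>, which exceeds \<open>2 * T\<close>. At most \<open>k\<close>
  positions are not clean, so the true word has at most \<open>k\<close> mismatches and any other
  more than \<open>2 * k - k\<close>. Only one candidate passes, and \<open>LEAST\<close> finds
  it.\<close>

lemma block_decoding_correct:
  assumes T: "0 \<le> T" and d: "4 * T < hmin * d"
    and gb: "\<And>j l. j < n \<Longrightarrow> hmin \<le> cmod (g j l)" and hmin: "0 < hmin"
    and sep: "\<And>m m' j. m < m0 \<Longrightarrow> m' < m0 \<Longrightarrow> j < n \<Longrightarrow> cw m j \<noteq> cw m' j \<Longrightarrow> d \<le> cmod (cw m j - cw m' j)"
    and dist: "\<And>m m'. m < m0 \<Longrightarrow> m' < m0 \<Longrightarrow> m \<noteq> m' \<Longrightarrow> 2 * k < card {j. j < n \<and> cw m j \<noteq> cw m' j}"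
    and noise: "card {i \<in> {..<3 * n} \<times> UNIV. T < cmod (z i)} \<le> k" and w: "w t < m0"
  shows "estimate s 3 (3 * n) (block_enc cw) (block_dec n m0 k T cw) w g z t = w t"
proof -
  let ?y = "\<lambda>i. if i < 3 * n then rx_sig s 3 (block_enc cw) w g z (dest t) i else 0"
  let ?h = "\<lambda>i t'. if i < 3 * n \<and> conn (dest t) t' then chan 3 g i (dest t) t' else 0"
  \<comment> \<open>Samples at all receivers are counted, so a single noise event controls the
    errors of all eight users.\<close>
  let ?bad = "(\<lambda>i. fst i div 3) ` {i \<in> {..<3 * n} \<times> (UNIV :: rx set). T < cmod (z i)}"
  let ?S = "\<lambda>m. mismatches n T cw t ?y ?h m"
  have fin: "finite {i \<in> {..<3 * n} \<times> (UNIV :: rx set). T < cmod (z i)}" by simp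
  have bad: "card ?bad \<le> k"
    using card_image_le[OF fin, of "\<lambda>i. fst i div 3"] noise by linarith
  have zf: "zero_force t ?y j - ?h (3 * j) t * cw m j
      = g j (dest t, t) * (cw (w t) j - cw m j) + zero_force t (\<lambda>n. z (n, dest t)) j" if "j < n" for j m
  proof -
    have "zero_force t ?y j = zero_force t (rx_sig s 3 (block_enc cw) w g z (dest t)) j"
      by (rule zero_force_cong) (use that in auto)
    then show ?thesis
      using that by (simp add: zero_force_rx_sig conn_dest chan_def algebra_simps)
  qed
  have small: "cmod (zero_force t (\<lambda>n. z (n, dest t)) j) \<le> 2 * T" if j: "j < n" "j \<notin> ?bad" for j
  proof (rule cmod_zero_force_le[OF _ T])
    fix i :: nat assume i: "i < 3"
    have "(3 * j + i) div 3 = j" using i by simp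
    show "cmod (z (3 * j + i, dest t)) \<le> T"
    proof (rule ccontr)
      assume "\<not> ?thesis"
      with \<open>(3 * j + i) div 3 = j\<close> have "j \<in> ?bad"
        using j i by (intro image_eqI[of _ _ "(3 * j + i, dest t)"]) auto
      with j show False by simp
    qed
  qed
  have "?S (w t) \<subseteq> ?bad"
    using small zf by (force simp: mismatches_def)
  then have "card (?S (w t)) \<le> card ?bad"
    by (rule card_mono[OF finite_imageI[OF fin]])
  with bad have passes: "card (?S (w t)) \<le> k" by (rule order_trans[rotated])
  have unique: "m = w t" if m: "m < m0" "card (?S m) \<le> k" for m
  proof (rule ccontr)
    assume "m \<noteq> w t"
    then have "2 * k < card {j. j < n \<and> cw (w t) j \<noteq> cw m j}" using dist[OF w m(1)] by simp
    also have "{j. j < n \<and> cw (w t) j \<noteq> cw m j} \<subseteq> ?S m \<union> ?bad"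
    proof
      fix j assume j: "j \<in> {j. j < n \<and> cw (w t) j \<noteq> cw m j}"
      show "j \<in> ?S m \<union> ?bad"
      proof (cases "j \<in> ?bad")
        case False
        have "hmin * d \<le> hmin * cmod (cw (w t) j - cw m j)"
          using sep[OF w m(1)] j hmin by (intro mult_left_mono) auto
        also have "\<dots> \<le> cmod (g j (dest t, t)) * cmod (cw (w t) j - cw m j)"
          using gb[of j] j by (intro mult_right_mono) auto
        also have "\<dots> \<le> cmod (g j (dest t, t) * (cw (w t) j - cw m j) + zero_force t (\<lambda>n. z (n, dest t)) j)
            + cmod (zero_force t (\<lambda>n. z (n, dest t)) j)"
          unfolding norm_mult[symmetric]
          using norm_triangle_ineq4[of "g j (dest t, t) * (cw (w t) j - cw m j) + zero_force t (\<lambda>n. z (n, dest t)) j"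
              "zero_force t (\<lambda>n. z (n, dest t)) j"] by simp
        finally have "2 * T < cmod (zero_force t ?y j - ?h (3 * j) t * cw m j)"
          using zf[of j m] small[of j] j False d by auto
        then show ?thesis using j by (simp add: mismatches_def)
      qed simp
    qed
    then have "card {j. j < n \<and> cw (w t) j \<noteq> cw m j} \<le> card (?S m \<union> ?bad)"
      using fin by (intro card_mono) (auto simp: mismatches_def)
    also have "\<dots> \<le> card (?S m) + card ?bad" by (rule card_Un_le)
    finally show False using m bad by simp
  qed
  have "(LEAST m. m < m0 \<and> card (?S m) \<le> k) = w t"
  proof (rule Least_equality)
    show "w t < m0 \<and> card (?S (w t)) \<le> k" by (rule conjI[OF w passes])
    show "w t \<le> m" if "m < m0 \<and> card (?S m) \<le> k" for m
      by (rule eq_refl[OF unique[OF conjunct1[OF that] conjunct2[OF that], symmetric]])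
  qed
  then show ?thesis by (simp add: estimate_def block_dec_def)
qed

lemma measurable_Omega_block_tx_sig:
  "(\<lambda>(w, g, z). tx_sig s (block_enc cw) w g t n) \<in> borel_measurable (Omega M N \<nu>)"
  using measurable_compose[OF measurable_Omega_msg[of t M N \<nu>], of "\<lambda>m. direction t (n mod 3) * cw m (n div 3)" borel]
  by (simp add: tx_sig_def block_enc_def case_prod_beta')

lemma measurable_block_estimate:
  assumes adm: "admissible_fading \<nu> hmin hmax"
  shows "(\<lambda>(w, g, z). estimate s 3 (3 * n) (block_enc cw) (block_dec n m0 k T cw) w g z t)
    \<in> measurable (Omega M (3 * n) \<nu>) (count_space UNIV)"
proof -
  let ?O = "Omega M (3 * n) \<nu>"
  let ?y = "\<lambda>w g z i. if i < 3 * n then rx_sig s 3 (block_enc cw) w g z (dest t) i else 0"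
  let ?h = "\<lambda>g i t'. if i < 3 * n \<and> conn (dest t) t' then chan 3 g i (dest t) t' else 0"
  have y: "(\<lambda>\<omega>. case \<omega> of (w, g, z) \<Rightarrow> ?y w g z i) \<in> borel_measurable ?O" for i
  proof (cases "i < 3 * n")
    case True
    have "(\<lambda>\<omega>. (case \<omega> of (w, g, z) \<Rightarrow> noiseless s 3 (block_enc cw) w g (dest t) i) + (case \<omega> of (w, g, z) \<Rightarrow> z (i, dest t)))
        \<in> borel_measurable ?O"
      by (intro borel_measurable_add measurable_Omega_noise[OF True]
          measurable_Omega_noiseless[OF adm True] measurable_Omega_block_tx_sig)
    then show ?thesis using True by (simp add: rx_sig_eq case_prod_beta')
  qed (simp add: case_prod_beta')
  have h: "(\<lambda>\<omega>. case \<omega> of (w, g, z) \<Rightarrow> ?h g i t') \<in> borel_measurable ?O" for i t'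
  proof (cases "i < 3 * n \<and> conn (dest t) t'")
    case True
    then have "i div 3 < 3 * n" by auto
    from measurable_Omega_fade[OF adm this] show ?thesis
      using True by (simp add: chan_def case_prod_beta')
  qed (auto simp: case_prod_beta')
  have zf: "(\<lambda>\<omega>. case \<omega> of (w, g, z) \<Rightarrow> zero_force t (?y w g z) j) \<in> borel_measurable ?O" for j
    using y unfolding case_prod_beta' by (rule measurable_zero_force)
  have mis: "(\<lambda>\<omega>. case \<omega> of (w, g, z) \<Rightarrow> card (mismatches n T cw t (?y w g z) (?h g) m) \<le> k)
      \<in> measurable ?O (count_space UNIV)" for m
  proof -
    \<comment> \<open>The cardinality is rewritten as a finite sum of indicators of measurable
      conditions, from which measurability of the decoder follows.\<close>
    have card: "(real (card (mismatches n T cw t u v m)) =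
        (\<Sum>j<n. indicator {x. 2 * T < x} (cmod (zero_force t u j - v (3 * j) t * cw m j))))" for u v
    proof -
      have "(\<Sum>j<n. indicator {x. 2 * T < x} (cmod (zero_force t u j - v (3 * j) t * cw m j)) :: real)
          = (\<Sum>j<n. if j \<in> mismatches n T cw t u v m then 1 else 0)"
        by (intro sum.cong) (auto simp: mismatches_def)
      also have "\<dots> = (\<Sum>j\<in>{..<n} \<inter> mismatches n T cw t u v m. 1)"
        by (rule sum.inter_restrict[symmetric]) simp
      also have "{..<n} \<inter> mismatches n T cw t u v m = mismatches n T cw t u v m"
        by (auto simp: mismatches_def)
      finally show ?thesis by simp
    qed
    note [measurable] = zf[unfolded case_prod_beta'] h[unfolded case_prod_beta']
    have card_le: "card (mismatches n T cw t u v m) \<le> k \<longleftrightarrow>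
        (\<Sum>j<n. indicator {x. 2 * T < x} (cmod (zero_force t u j - v (3 * j) t * cw m j))) \<le> real k" for u v
      unfolding card[symmetric] by simp
    have "(\<lambda>\<omega>. (\<Sum>j<n. indicator {x. 2 * T < x} (cmod (zero_force t (?y (fst \<omega>) (fst (snd \<omega>)) (snd (snd \<omega>))) j
          - ?h (fst (snd \<omega>)) (3 * j) t * cw m j))) \<le> real k) \<in> measurable ?O (count_space UNIV)"
      by measurable
    then show ?thesis
      unfolding case_prod_beta' card_le .
  qed
  have "(\<lambda>\<omega>. LEAST m. m < m0 \<and> (case \<omega> of (w, g, z) \<Rightarrow> card (mismatches n T cw t (?y w g z) (?h g) m) \<le> k))
      \<in> measurable ?O (count_space UNIV)"
    using mis by measurable
  then show ?thesis
    unfolding estimate_def block_dec_def case_prod_beta' .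
qed

text \<open>All users share one codebook of minimum distance above \<open>2 * k\<close> over a
  square grid. Up to null sets an error requires more than \<open>k\<close> large samples among the
  \<open>4 * (3 * n)\<close> in the block, which explains the exponent
  \<open>12 * n\<close>.\<close>

lemma good_block_code:
  assumes adm: "admissible_fading \<nu> hmin hmax" and T: "0 \<le> T" and d: "4 * T < hmin * d"
    and L: "1 \<le> L" and pow: "2 * (real L)\<^sup>2 * d\<^sup>2 \<le> P"
  obtains M enc dec where
    "good_code s 3 \<nu> P (3 * n) M enc dec (2 ^ (12 * n) * (4 * exp (- T\<^sup>2 / 4)) ^ (k + 1))"
    and "\<And>t. (L\<^sup>2) ^ n \<le> M t * (2 ^ n * (L\<^sup>2) ^ (2 * k))"
proof -
  have hmin: "0 < hmin" using adm by (simp add: admissible_fading_def)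
  have "0 < hmin * d" using T d by linarith
  then have d0: "0 < d" using hmin by (simp add: zero_less_mult_iff)
  obtain A :: "complex set" where A: "finite A" "card A = L\<^sup>2"
    and Apow: "\<And>x. x \<in> A \<Longrightarrow> (cmod x)\<^sup>2 \<le> 2 * (real L)\<^sup>2 * d\<^sup>2"
    and Asep: "\<And>x y. x \<in> A \<Longrightarrow> y \<in> A \<Longrightarrow> x \<noteq> y \<Longrightarrow> d \<le> cmod (x - y)"
    by (rule qam_constellation[OF d0, of L]) (use that in blast)
  have "1 \<le> L\<^sup>2" using L by simp
  obtain C where C: "C \<subseteq> (\<Pi>\<^sub>E j\<in>{..<n}. A)"
    and Cdist: "\<And>x y. x \<in> C \<Longrightarrow> y \<in> C \<Longrightarrow> x \<noteq> y \<Longrightarrow> 2 * k < card {j. j < n \<and> x j \<noteq> y j}"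
    and Csize: "(L\<^sup>2) ^ n \<le> card C * (2 ^ n * (L\<^sup>2) ^ (2 * k))"
    by (rule gilbert_varshamov[OF A \<open>1 \<le> L\<^sup>2\<close>, of n "2 * k"]) (use that in blast)
  have finC: "finite C" using C A by (auto intro: finite_subset finite_PiE)
  define m0 where "m0 = card C"
  have m0: "1 \<le> m0"
  proof (rule ccontr)
    assume "\<not> 1 \<le> m0"
    then have "card C = 0" by (simp add: m0_def)
    then have "(L\<^sup>2) ^ n \<le> 0" using Csize by (simp only: mult_zero_left)
    then show False using L by simp
  qed
  obtain c where c: "bij_betw c {0..<m0} C"
    using ex_bij_betw_nat_finite[OF finC] by (auto simp: m0_def)
  \<comment> \<open>Message values from \<open>m0\<close> on have probability zero, but they belong
    to the message space. The default 0 keeps the power bound valid at every sample point.\<close>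
  define cw where "cw = (\<lambda>m j. if m < m0 \<and> j < n then c m j else 0)"
  have cC: "c m \<in> C" if "m < m0" for m using c that by (auto simp: bij_betw_def)
  have cwA: "cw m j \<in> A" if "m < m0" "j < n" for m j
    using cC[OF that(1)] C that by (auto simp: cw_def PiE_iff)
  have P: "0 \<le> P" using pow by (rule order_trans[rotated]) simp
  have cwP: "(cmod (cw m j))\<^sup>2 \<le> P" for m j
    using Apow[OF cwA[of m j]] pow P by (cases "m < m0 \<and> j < n") (auto simp: cw_def)
  have sep: "d \<le> cmod (cw m j - cw m' j)" if "m < m0" "m' < m0" "j < n" "cw m j \<noteq> cw m' j" for m m' j
    using Asep[OF cwA cwA] that by auto
  have dist: "2 * k < card {j. j < n \<and> cw m j \<noteq> cw m' j}" if "m < m0" "m' < m0" "m \<noteq> m'" for m m'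
  proof -
    have "c m \<noteq> c m'" using c that by (auto simp: bij_betw_def inj_on_def)
    moreover have "{j. j < n \<and> cw m j \<noteq> cw m' j} = {j. j < n \<and> c m j \<noteq> c m' j}"
      using that by (auto simp: cw_def)
    ultimately show ?thesis using Cdist[OF cC cC] that by simp
  qed
  let ?M = "\<lambda>_ :: tx. m0" and ?enc = "block_enc cw" and ?dec = "block_dec n m0 k T cw"
  let ?O = "Omega ?M (3 * n) \<nu>" and ?\<epsilon> = "2 ^ (12 * n) * (4 * exp (- T\<^sup>2 / 4)) ^ (k + 1)"
  interpret O: prob_space ?O by (rule prob_space_Omega[OF adm])
  have "good_code s 3 \<nu> P (3 * n) ?M ?enc ?dec ?\<epsilon>"
    unfolding good_code_def
  proof (intro conjI allI impI)
    show "1 \<le> m0" by (rule m0)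
    show "(\<lambda>(w, g, z). tx_sig s ?enc w g t i) \<in> borel_measurable ?O" for t i
      by (rule measurable_Omega_block_tx_sig)
    show "(\<integral>\<^sup>+ \<omega>. ennreal ((cmod (case \<omega> of (w, g, z) \<Rightarrow> tx_sig s ?enc w g t i))\<^sup>2) \<partial>?O) \<le> ennreal P" for t i
    proof -
      have "(cmod (tx_sig s ?enc w g t i))\<^sup>2 \<le> P" for w g
      proof -
        have "(cmod (direction t (i mod 3)))\<^sup>2 * (cmod (cw (w t) (i div 3)))\<^sup>2 \<le> 1 * P"
          using cmod_direction_le by (intro mult_mono cwP) (auto simp: power_le_one)
        then show ?thesis by (simp add: tx_sig_def block_enc_def norm_mult power_mult_distrib)
      qed
      then have "(\<integral>\<^sup>+ \<omega>. ennreal ((cmod (case \<omega> of (w, g, z) \<Rightarrow> tx_sig s ?enc w g t i))\<^sup>2) \<partial>?O) \<le> (\<integral>\<^sup>+ \<omega>. ennreal P \<partial>?O)"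
        by (intro nn_integral_mono ennreal_leI) (auto simp: case_prod_beta')
      then show ?thesis by (simp add: O.emeasure_space_1)
    qed
    have est: "{\<omega> \<in> space ?O. (case \<omega> of (w, g, z) \<Rightarrow> estimate s 3 (3 * n) ?enc ?dec w g z t) \<noteq> (case \<omega> of (w, g, z) \<Rightarrow> w t)} \<in> sets ?O" for t
    proof -
      have [measurable]: "(\<lambda>\<omega>. real (f \<omega>)) \<in> borel_measurable ?O" if "f \<in> measurable ?O (count_space UNIV)" for f
        by (rule measurable_compose[OF that]) simp
      note [measurable] = measurable_block_estimate[OF adm, of s n cw m0 k T t ?M] measurable_Omega_msg[of t ?M "3 * n" \<nu>]
      have "{\<omega> \<in> space ?O. real (case \<omega> of (w, g, z) \<Rightarrow> estimate s 3 (3 * n) ?enc ?dec w g z t) \<noteq> real (case \<omega> of (w, g, z) \<Rightarrow> w t)} \<in> sets ?O"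
        by measurable
      then show ?thesis by (simp only: of_nat_eq_iff)
    qed
    have "err_event s 3 \<nu> (3 * n) ?M ?enc ?dec = (\<Union>t\<in>UNIV. {\<omega> \<in> space ?O.
        (case \<omega> of (w, g, z) \<Rightarrow> estimate s 3 (3 * n) ?enc ?dec w g z t) \<noteq> (case \<omega> of (w, g, z) \<Rightarrow> w t)})"
      unfolding err_event_def by auto
    also have "\<dots> \<in> sets ?O" by (rule sets.finite_UN) (use est in auto)
    finally show "err_event s 3 \<nu> (3 * n) ?M ?enc ?dec \<in> sets ?O" .
    obtain U where U: "U \<in> sets (noise_space (3 * n))"
      and sub: "{z \<in> space (noise_space (3 * n)). k < card {i \<in> {..<3 * n} \<times> UNIV. T < cmod (z i)}} \<subseteq> U"
      and eU: "emeasure (noise_space (3 * n)) U \<le> ennreal (2 ^ (4 * (3 * n)) * (4 * exp (- T\<^sup>2 / 4)) ^ (k + 1))"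
      by (rule emeasure_many_large_noise[OF T, of "3 * n" k]) (use that in blast)
    have "AE \<omega> in ?O. case \<omega> of (w, g, z) \<Rightarrow> \<forall>t. w t < m0"
      using m0 by (intro AE_Omega_msg[OF adm, where M = ?M])
    with AE_Omega_fade[OF adm AE_fade_bounds[OF adm, of "3 * n"], of ?M]
    \<comment> \<open>Outside the null sets where a message is out of range or a gain lies below
      \<open>hmin\<close>, decoding can fail only if the noise lies in \<open>U\<close>.\<close>
    have "AE \<omega> in ?O. \<omega> \<in> err_event s 3 \<nu> (3 * n) ?M ?enc ?dec \<longrightarrow> \<omega> \<in> {\<omega> \<in> space ?O. snd (snd \<omega>) \<in> U}"
    proof eventually_elim
      fix \<omega> :: "(tx \<Rightarrow> nat) \<times> (nat \<Rightarrow> rx \<times> tx \<Rightarrow> complex) \<times> (nat \<times> rx \<Rightarrow> complex)"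
      assume g: "case \<omega> of (w, g, z) \<Rightarrow> \<forall>b<3 * n. \<forall>l. hmin \<le> cmod (g b l) \<and> cmod (g b l) \<le> hmax"
        and w: "case \<omega> of (w, g, z) \<Rightarrow> \<forall>t. w t < m0"
      obtain w g z where \<omega>: "\<omega> = (w, g, z)" by (cases \<omega>)
      have "estimate s 3 (3 * n) ?enc ?dec w g z t = w t"
        if "card {i \<in> {..<3 * n} \<times> UNIV. T < cmod (z i)} \<le> k" for t
        by (rule block_decoding_correct[OF T d _ hmin sep dist that])
          (use g w in \<open>auto simp: \<omega>\<close>)
      then have "k < card {i \<in> {..<3 * n} \<times> UNIV. T < cmod (z i)}"
        if "\<omega> \<in> err_event s 3 \<nu> (3 * n) ?M ?enc ?dec"
        using that unfolding err_event_def \<omega> by (auto simp: not_le[symmetric])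
      then show "\<omega> \<in> err_event s 3 \<nu> (3 * n) ?M ?enc ?dec \<longrightarrow> \<omega> \<in> {\<omega> \<in> space ?O. snd (snd \<omega>) \<in> U}"
        using sub by (auto simp: \<omega> err_event_def Omega_def space_pair_measure)
    qed
    then have "emeasure ?O (err_event s 3 \<nu> (3 * n) ?M ?enc ?dec) \<le> emeasure ?O {\<omega> \<in> space ?O. snd (snd \<omega>) \<in> U}"
      by (rule emeasure_mono_AE) (rule emeasure_Omega_noise[OF adm U])
    also have "\<dots> \<le> ennreal ?\<epsilon>"
      using eU by (simp add: emeasure_Omega_noise[OF adm U])
    finally show "measure ?O (err_event s 3 \<nu> (3 * n) ?M ?enc ?dec) \<le> ?\<epsilon>"
      by (simp add: O.emeasure_eq_measure)
  qed
  then show ?thesis using Csize by (intro that[of ?M ?enc ?dec]) (simp_all add: m0_def)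
qed

section \<open>Choice of parameters\<close>

text \<open>The union bound costs \<open>12 * n\<close> bits, and one more bit per symbol leaves
  error \<open>2 powr (- n)\<close>; with \<open>m\<close> bits gained per large sample,
  \<open>k\<close> about \<open>13 * n / m\<close> pays for both. Distance \<open>2 * k\<close>
  costs \<open>4 * k * log 2 L\<close> bits, which is the fraction \<open>26 / m\<close> of the raw
  \<open>2 * n * log 2 L\<close>. The subtracted 1 is the packing loss, and the division by 3
  reflects three uses per symbol.\<close>

lemma achievable_block:
  assumes adm: "admissible_fading \<nu> hmin hmax" and T: "0 \<le> T" and d: "4 * T < hmin * d"
    and L: "1 \<le> L" and pow: "2 * (real L)\<^sup>2 * d\<^sup>2 \<le> P" and m: "0 < m"
    and tail: "4 * exp (- T\<^sup>2 / 4) \<le> 2 powr (- m)"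
    and r: "0 \<le> r" "r \<le> ((1 - 26 / m) * 2 * log 2 L - 1) / 3"
  shows "achievable s 3 \<nu> P (\<lambda>_. r)"
  unfolding achievable_def
proof (intro conjI allI impI)
  show "0 \<le> r" by fact
  fix \<epsilon> :: real and N0 :: nat assume \<epsilon>: "0 < \<epsilon>"
  obtain n0 where n0: "(1/2 :: real) ^ n0 < \<epsilon>" using real_arch_pow_inv[OF \<epsilon>, of "1/2"] by auto
  \<comment> \<open>The three summands secure error at most \<open>\<epsilon>\<close>, block length
    at least \<open>N0\<close>, and positivity.\<close>
  define n where "n = n0 + N0 + 1"
  have n: "0 < n" "N0 \<le> 3 * n" by (auto simp: n_def)
  have "(1/2 :: real) ^ n \<le> (1/2) ^ n0" unfolding n_def by (intro power_decreasing) auto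
  with n0 have n\<epsilon>: "(1/2 :: real) ^ n \<le> \<epsilon>" by linarith
  \<comment> \<open>Rounding down bounds the rate loss, while \<open>k + 1\<close>, the exponent in
    the error bound, is still at least \<open>13 * n / m\<close>.\<close>
  define k where "k = nat \<lfloor>13 * n / m\<rfloor>"
  have k: "real k \<le> 13 * n / m" "13 * n / m \<le> real (k + 1)"
  proof -
    have "0 \<le> 13 * n / m" using m by simp
    then show "real k \<le> 13 * n / m" "13 * n / m \<le> real (k + 1)"
      unfolding k_def by linarith+
  qed
  obtain M enc dec where
    good: "good_code s 3 \<nu> P (3 * n) M enc dec (2 ^ (12 * n) * (4 * exp (- T\<^sup>2 / 4)) ^ (k + 1))"
    and size: "\<And>t. (L\<^sup>2) ^ n \<le> M t * (2 ^ n * (L\<^sup>2) ^ (2 * k))"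
    by (rule good_block_code[OF adm T d L pow, of s n k]) (use that in blast)
  have "2 ^ (12 * n) * (4 * exp (- T\<^sup>2 / 4)) ^ (k + 1) \<le> 2 ^ (12 * n) * (2 powr (- m)) ^ (k + 1)"
    by (intro mult_left_mono power_mono tail) auto
  also have "\<dots> = 2 powr (12 * n - m * (k + 1))"
    by (simp add: powr_realpow[symmetric] powr_powr powr_add[symmetric] algebra_simps del: powr_realpow)
  also have "\<dots> \<le> 2 powr (- real n)"
    using k(2) m by (intro powr_mono) (auto simp: field_simps)
  also have "\<dots> = (1/2) ^ n" by (simp add: powr_minus_divide powr_realpow power_one_over)
  finally have err: "2 ^ (12 * n) * (4 * exp (- T\<^sup>2 / 4)) ^ (k + 1) \<le> \<epsilon>" using n\<epsilon> by simp
  have "good_code s 3 \<nu> P (3 * n) M enc dec \<epsilon>"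
    using good err unfolding good_code_def by (meson order_trans)
  moreover have "r - \<epsilon> \<le> log 2 (real (M t)) / real (3 * n)" for t
  proof -
    have M: "1 \<le> M t" using good by (auto simp: good_code_def)
    have "real ((L\<^sup>2) ^ n) \<le> real (M t * (2 ^ n * (L\<^sup>2) ^ (2 * k)))"
      using size by (rule of_nat_mono)
    then have "log 2 (real ((L\<^sup>2) ^ n)) \<le> log 2 (real (M t * (2 ^ n * (L\<^sup>2) ^ (2 * k))))"
      using L by (intro log_mono) auto
    then have "2 * n * log 2 L \<le> log 2 (M t) + n + 4 * k * log 2 L"
      using L M by (simp add: log_mult log_nat_power)
    moreover have "4 * k * log 2 L \<le> 4 * (13 * n / m) * log 2 L"
      using k(1) L by (intro mult_right_mono) auto
    ultimately have "n * ((1 - 26 / m) * 2 * log 2 L - 1) \<le> log 2 (M t)"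
      by (simp add: algebra_simps)
    then have "((1 - 26 / m) * 2 * log 2 L - 1) / 3 \<le> log 2 (M t) / (3 * n)"
      using n by (simp add: field_simps)
    then show ?thesis using r \<epsilon> by simp
  qed
  ultimately show "\<exists>N\<ge>N0. 0 < N \<and> (\<exists>M enc dec. good_code s 3 \<nu> P N M enc dec \<epsilon> \<and> (\<forall>t. r - \<epsilon> \<le> log 2 (real (M t)) / real N))"
    using n by (intro exI[of _ "3 * n"] conjI exI[of _ M] exI[of _ enc] exI[of _ dec]) auto
qed

text \<open>Grid side for spacing \<open>5 * T / hmin\<close>, where \<open>T\<^sup>2 / 4 = ln 2 * (m + 2)\<close> makes noise samples exceed
  \<open>T\<close> with probability at most \<open>2 powr - m\<close>. The choice \<open>m = sqrt (log 2 P)\<close> tends to infinity, so the code loses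
  no rate asymptotically, yet slowly enough that \<open>ln T\<close> is negligible against \<open>ln P\<close>.\<close>
definition qam_side :: "real \<Rightarrow> real \<Rightarrow> real" where
  "qam_side hmin P = sqrt (P / 2) / (10 * sqrt (ln 2 * (sqrt (log 2 P) + 2)) / hmin)"

text \<open>The rate of the block code with \<open>m = sqrt (log 2 P)\<close>. Subtracting 1 from
  \<open>qam_side\<close> allows for rounding the grid side down to an integer.\<close>

definition user_rate :: "real \<Rightarrow> real \<Rightarrow> real" where
  "user_rate hmin P = ((1 - 26 / sqrt (log 2 P)) * 2 * log 2 (qam_side hmin P - 1) - 1) / 3"

lemma achievable_user_rate:
  assumes adm: "admissible_fading \<nu> hmin hmax" and P: "1 < P"
    and side: "2 \<le> qam_side hmin P" and m: "26 \<le> sqrt (log 2 P)" and r: "0 \<le> user_rate hmin P"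
  shows "achievable s 3 \<nu> P (\<lambda>_. user_rate hmin P)"
proof -
  have hmin: "0 < hmin" using adm by (simp add: admissible_fading_def)
  define m where "m = sqrt (log 2 P)"
  define T where "T = 2 * sqrt (ln 2 * (m + 2))"
  define d where "d = 5 * T / hmin"
  define L where "L = nat \<lfloor>qam_side hmin P\<rfloor>"
  have m26: "26 \<le> m" using m by (simp add: m_def)
  have T: "0 < T" using m26 by (simp add: T_def)
  have d: "0 < d" using T hmin by (simp add: d_def)
  have qs: "qam_side hmin P = sqrt (P / 2) / d" by (simp add: qam_side_def d_def T_def m_def)
  have L: "real L \<le> qam_side hmin P" "qam_side hmin P - 1 \<le> real L"
    using side unfolding L_def by (simp, linarith)
  show ?thesis
  proof (rule achievable_block[OF adm, where T = T and d = d and L = L and m = m])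
    show "4 * T < hmin * d" using T hmin by (simp add: d_def)
    show "1 \<le> L" using side L by linarith
    have "(real L)\<^sup>2 \<le> (sqrt (P / 2) / d)\<^sup>2" using L by (intro power_mono) (auto simp: qs)
    then show "2 * (real L)\<^sup>2 * d\<^sup>2 \<le> P" using P d by (simp add: power_divide field_simps)
    \<comment> \<open>The summand 2 yields a factor 1/4, which absorbs the constant 4 of the tail
      bound.\<close>
    have "T\<^sup>2 / 4 = (m + 2) * ln 2" using m26 by (simp add: T_def power_mult_distrib)
    then have "- T\<^sup>2 / 4 = - (m + 2) * ln 2"
      by (simp only: minus_divide_left[symmetric] mult_minus_left)
    then have "exp (- T\<^sup>2 / 4) = 2 powr (- (m + 2))" by (simp only: powr_def) simp
    also have "\<dots> = 2 powr (- m) * 2 powr (- 2)" by (simp flip: powr_add)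
    finally show "4 * exp (- T\<^sup>2 / 4) \<le> 2 powr (- m)" by (simp add: powr_minus)
    have "log 2 (qam_side hmin P - 1) \<le> log 2 L" using side L by (intro log_mono) auto
    \<comment> \<open>The lower bound on \<open>m\<close> keeps the redundancy factor nonnegative,
      so a larger grid side does not lower the rate.\<close>
    moreover have "26 / m \<le> 1" using m26 by simp
    then have "0 \<le> (1 - 26 / m) * 2" by (intro mult_nonneg_nonneg) auto
    ultimately have "(1 - 26 / m) * 2 * log 2 (qam_side hmin P - 1) \<le> (1 - 26 / m) * 2 * log 2 L"
      by (rule mult_left_mono)
    then show "user_rate hmin P \<le> ((1 - 26 / m) * 2 * log 2 L - 1) / 3"
      unfolding user_rate_def m_def[symmetric] by simp
  qed (use T m26 r in auto)
qed

section \<open>Sum capacity and its limit\<close>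

text \<open>A supremum of reals is informative only for nonempty sets bounded above. The zero rate
  tuple gives the former and the converse the latter, uniformly in the coherence time, so the bound
  survives the maximum over \<open>\<tau>\<close>.\<close>

lemma sum_capacity_bounds:
  assumes adm: "admissible_fading \<nu> hmin hmax" and \<tau>: "3 \<le> \<tau>max" and P: "4 \<le> P"
  shows "sum_capacity s \<tau>max \<nu> P
      \<le> 8/3 * (log 2 P + (log 2 ((3 * hmax / hmin)\<^sup>2 * exp (128 * hmax\<^sup>2)) + 2))" (is "_ \<le> ?B")
    and "achievable s 3 \<nu> P R \<Longrightarrow> (\<Sum>t\<in>UNIV. R t) \<le> sum_capacity s \<tau>max \<nu> P"
proof -
  have B: "x \<le> ?B" if "x \<in> {(\<Sum>t\<in>UNIV. R t) | R. achievable s \<tau> \<nu> P R}" for x \<tau>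
    using that sum_rate_bound[OF adm _ P] by auto
  then have bdd: "bdd_above {(\<Sum>t\<in>UNIV. R t) | R. achievable s \<tau> \<nu> P R}" for \<tau>
    by (rule bdd_aboveI)
  have zero: "achievable s \<tau> \<nu> P (\<lambda>_. 0)" for \<tau>
    unfolding achievable_def
  proof (intro conjI allI impI)
    fix \<epsilon> :: real and N0 :: nat assume \<epsilon>: "0 < \<epsilon>"
    \<comment> \<open>With one message per user the decoder 0 errs only where some message differs
      from 0. This set is nonempty in the message space but has measure zero.\<close>
    let ?N = "Suc N0" and ?M = "\<lambda>_ :: tx. 1 :: nat" and ?enc = "(\<lambda>_ _ _ _. 0) :: encoder" and ?dec = "(\<lambda>_ _ _ _. 0) :: decoder"
    have AE: "AE \<omega> in Omega ?M ?N \<nu>. \<omega> \<notin> err_event s \<tau> \<nu> ?N ?M ?enc ?dec"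
      using AE_Omega_msg[OF adm, of ?M ?N] by (auto simp: err_event_def estimate_def elim: eventually_mono)
    have err: "err_event s \<tau> \<nu> ?N ?M ?enc ?dec \<in> sets (Omega ?M ?N \<nu>)"
    proof -
      have "(\<lambda>(w, g, z). w t) -` (- {0}) \<inter> space (Omega ?M ?N \<nu>) \<in> sets (Omega ?M ?N \<nu>)" for t
        by (rule measurable_sets[OF measurable_Omega_msg]) simp
      moreover have "err_event s \<tau> \<nu> ?N ?M ?enc ?dec
          = (\<Union>t\<in>UNIV. (\<lambda>(w, g, z). w t) -` (- {0}) \<inter> space (Omega ?M ?N \<nu>))"
        by (auto simp: err_event_def estimate_def)
      ultimately show ?thesis by (simp only:) (rule sets.finite_UN, auto)
    qed
    have "measure (Omega ?M ?N \<nu>) (err_event s \<tau> \<nu> ?N ?M ?enc ?dec) = 0"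
      by (rule measure_eq_0_null_sets[OF iffD2[OF AE_iff_null_sets[OF err] AE]])
    then have "good_code s \<tau> \<nu> P ?N ?M ?enc ?dec \<epsilon>"
      using \<epsilon> err
      by (simp add: good_code_def tx_sig_def case_prod_beta')
    then show "\<exists>N\<ge>N0. 0 < N \<and> (\<exists>M enc dec. good_code s \<tau> \<nu> P N M enc dec \<epsilon> \<and> (\<forall>t. 0 - \<epsilon> \<le> log 2 (real (M t)) / real N))"
      using \<epsilon> by (intro exI[of _ ?N] conjI exI[of _ ?M] exI[of _ ?enc] exI[of _ ?dec]) auto
  qed simp
  have "sum_capacity_tau s \<tau> \<nu> P \<le> ?B" for \<tau>
    unfolding sum_capacity_tau_def using zero B by (intro cSup_least) blast+
  then show "sum_capacity s \<tau>max \<nu> P \<le> ?B"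
    unfolding sum_capacity_def using \<tau> by (intro Max.boundedI) auto
  assume "achievable s 3 \<nu> P R"
  then have "(\<Sum>t\<in>UNIV. R t) \<le> sum_capacity_tau s 3 \<nu> P"
    unfolding sum_capacity_tau_def by (intro cSup_upper bdd) auto
  also have "\<dots> \<le> sum_capacity s \<tau>max \<nu> P"
    unfolding sum_capacity_def using \<tau> by (intro Max_ge) auto
  finally show "(\<Sum>t\<in>UNIV. R t) \<le> sum_capacity s \<tau>max \<nu> P" .
qed

text \<open>The grid side is \<open>sqrt P\<close> up to a constant and a power of
  \<open>log 2 P\<close>, so twice its logarithm is \<open>log 2 P\<close> up to lower order
  terms.\<close>

lemma tendsto_user_rate:
  assumes "0 < hmin"
  shows "((\<lambda>P. user_rate hmin P / log 2 P) \<longlongrightarrow> 1 / 3) at_top"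
  using assms unfolding user_rate_def qam_side_def by real_asymp

lemma filterlim_qam_side:
  assumes "0 < hmin"
  shows "filterlim (qam_side hmin) at_top at_top"
  using assms unfolding qam_side_def by real_asymp

theorem theorem6:
  fixes \<tau>max :: nat and \<nu> :: "rx \<times> tx \<Rightarrow> complex measure" and hmin hmax :: real
    and s :: csit and iid :: bool
  assumes "3 \<le> \<tau>max"
    and "admissible_fading \<nu> hmin hmax"
    and "iid \<longrightarrow> spatially_iid \<nu>"
  shows "((\<lambda>P. sum_capacity s \<tau>max \<nu> P / log 2 P) \<longlongrightarrow> 8 / 3) at_top"
proof -
  note adm = assms(2)
  have hmin: "0 < hmin" using adm by (simp add: admissible_fading_def)
  define C where "C = log 2 ((3 * hmax / hmin)\<^sup>2 * exp (128 * hmax\<^sup>2)) + 2"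
  have ev: "eventually (\<lambda>P :: real. 4 \<le> P) at_top"
    "eventually (\<lambda>P. 2 \<le> qam_side hmin P) at_top"
    "eventually (\<lambda>P. 26 \<le> sqrt (log 2 P)) at_top"
    \<comment> \<open>The limit 1/3 is positive, so the ratio is eventually positive; this provides
      the nonnegative rate that achievability demands.\<close>
    "eventually (\<lambda>P. 0 < user_rate hmin P / log 2 P) at_top"
  proof -
    show "eventually (\<lambda>P. 2 \<le> qam_side hmin P) at_top"
      using filterlim_qam_side[OF hmin] by (simp add: filterlim_at_top)
    have "filterlim (\<lambda>P. sqrt (log 2 P)) at_top at_top" by real_asymp
    then show "eventually (\<lambda>P. 26 \<le> sqrt (log 2 P)) at_top" by (simp add: filterlim_at_top)
    show "eventually (\<lambda>P. 0 < user_rate hmin P / log 2 P) at_top"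
      by (rule order_tendstoD[OF tendsto_user_rate[OF hmin]]) simp
  qed (rule eventually_ge_at_top)
  have upper: "eventually (\<lambda>P. sum_capacity s \<tau>max \<nu> P / log 2 P \<le> 8/3 * (log 2 P + C) / log 2 P) at_top"
    using ev(1) by eventually_elim
      (intro divide_right_mono sum_capacity_bounds(1)[OF adm assms(1), folded C_def], auto)
  have lower: "eventually (\<lambda>P. 8 * (user_rate hmin P / log 2 P) \<le> sum_capacity s \<tau>max \<nu> P / log 2 P) at_top"
    using ev
  proof eventually_elim
    fix P assume P: "4 \<le> P" and side: "2 \<le> qam_side hmin P" and m: "26 \<le> sqrt (log 2 P)"
      and pos: "0 < user_rate hmin P / log 2 P"
    have log: "0 < log 2 P" using P by simp
    with pos have r: "0 \<le> user_rate hmin P" by (simp add: zero_less_divide_iff)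
    have "achievable s 3 \<nu> P (\<lambda>_. user_rate hmin P)"
      using P by (intro achievable_user_rate[OF adm _ side m r]) auto
    from sum_capacity_bounds(2)[OF adm assms(1) P this]
    have "8 * user_rate hmin P \<le> sum_capacity s \<tau>max \<nu> P" by (simp add: UNIV_tx)
    then show "8 * (user_rate hmin P / log 2 P) \<le> sum_capacity s \<tau>max \<nu> P / log 2 P"
      using log by (simp add: divide_right_mono)
  qed
  have "((\<lambda>P. 8/3 * (log 2 P + C) / log 2 P) \<longlongrightarrow> 8 / 3) at_top" by real_asymp
  moreover have "((\<lambda>P. 8 * (user_rate hmin P / log 2 P)) \<longlongrightarrow> 8 / 3) at_top"
    using tendsto_mult_left[OF tendsto_user_rate[OF hmin], of 8] by simp
  ultimately show ?thesis
    by (intro tendsto_sandwich[OF lower upper])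
qed

end
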